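(* Let $1<p<\infty$ and let $\Omega\subset\mathbb{R}^2$ be a convex compact domain. Then $$K_p(\Omega)=\sup_{u\in\mathcal{U}_\Omega,\ u\ne 0}\frac{\|u_x\|_p}{\|u_y\|_p}<\infty$$ if and only if both vertical (that is, parallel to the $y$-axis) lines of support of $\Omega$ are angular.
   Context: A convex compact domain is a compact convex set $\Omega\subset\mathbb{R}^2$ with nonempty interior. $\mathcal{U}_\Omega$ denotes the class of continuous concave functions $u:\Omega\to\mathbb{R}$ with $u|_{\partial\Omega}=0$ whose gradient $\nabla u=(u_x,u_y)$ is uniformly bounded over all interior points of $\Omega$ at which it is defined (it is defined almost everywhere). $\|f\|_p=\left(\int_\Omega|f|^p\,dx\,dy\right)^{1/p}$. The tangent cone to $\Omega$ with vertex at $\xi\in\partial\Omega$ is the intersection of all closed half-planes containing $\Omega$ and bounded by lines of support of $\Omega$ through $\xi$. A point $\xi\in\partial\Omega$ is singular if there is more than one line of support to $\Omega$ through $\xi$ (equivalently, the tangent cone at $\xi$ is not a half-plane). A line is called an angular support line if, for some singular point $\xi\in\partial\Omega$, it intersects the tangent cone with vertex $\xi$ exactly in the point $\xi$. *)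

theory Defs
  imports "HOL-Analysis.Analysis"
begin

definition convex_compact_domain :: "(real \<times> real) set \<Rightarrow> bool" where
  "convex_compact_domain \<Omega> \<longleftrightarrow> convex \<Omega> \<and> compact \<Omega> \<and> interior \<Omega> \<noteq> {}"

definition deriv_x :: "(real \<times> real \<Rightarrow> real) \<Rightarrow> real \<times> real \<Rightarrow> real" where
  "deriv_x u z = deriv (\<lambda>t. u (t, snd z)) (fst z)"

definition deriv_y :: "(real \<times> real \<Rightarrow> real) \<Rightarrow> real \<times> real \<Rightarrow> real" where
  "deriv_y u z = deriv (\<lambda>t. u (fst z, t)) (snd z)"

text \<open>
  Functions on \<open>\<Omega>\<close> are represented by total functions whose values outside \<open>\<Omega>\<close> are irrelevant.
\<close>

definition concave_class :: "(real \<times> real) set \<Rightarrow> (real \<times> real \<Rightarrow> real) set" where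
  "concave_class \<Omega> = {u. continuous_on \<Omega> u \<and> concave_on \<Omega> u \<and> (\<forall>z\<in>frontier \<Omega>. u z = 0) \<and>
     (\<exists>B. \<forall>z\<in>interior \<Omega>. u differentiable (at z) \<longrightarrow> norm (deriv_x u z, deriv_y u z) \<le> B)}"

text \<open>
  For \<open>u\<close> in the class above, the points of \<open>\<Omega>\<close> where a partial derivative has an unspecified value
  (points of nondifferentiability, and the boundary, where it may depend on the values of \<open>u\<close> outside
  \<open>\<Omega>\<close>) form a Lebesgue null set. With the completed measure they do not affect the integral below,
  and its integrand is bounded almost everywhere, hence integrable.
\<close>

definition Lp_norm :: "real \<Rightarrow> (real \<times> real) set \<Rightarrow> (real \<times> real \<Rightarrow> real) \<Rightarrow> real" where
  "Lp_norm p \<Omega> f = (LINT z:\<Omega>|lebesgue. \<bar>f z\<bar> powr p) powr (1 / p)"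

text \<open>The supremum and the quotients are taken in \<^typ>\<open>ennreal\<close>, so an unbounded set has supremum \<open>\<infinity>\<close>.\<close>

definition K :: "real \<Rightarrow> (real \<times> real) set \<Rightarrow> ennreal" where
  "K p \<Omega> = (SUP u\<in>{u \<in> concave_class \<Omega>. \<exists>z\<in>\<Omega>. u z \<noteq> 0}.
     ennreal (Lp_norm p \<Omega> (deriv_x u)) / ennreal (Lp_norm p \<Omega> (deriv_y u)))"

definition is_line :: "(real \<times> real) set \<Rightarrow> bool" where
  "is_line L \<longleftrightarrow> (\<exists>a b. a \<noteq> 0 \<and> L = {z. a \<bullet> z = b})"

definition vertical_line :: "(real \<times> real) set \<Rightarrow> bool" where
  "vertical_line L \<longleftrightarrow> (\<exists>c. L = {z. fst z = c})"

definition support_line :: "(real \<times> real) set \<Rightarrow> (real \<times> real) set \<Rightarrow> bool" where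
  "support_line \<Omega> L \<longleftrightarrow>
     L \<inter> \<Omega> \<noteq> {} \<and> (\<exists>a b. a \<noteq> 0 \<and> L = {z. a \<bullet> z = b} \<and> \<Omega> \<subseteq> {z. a \<bullet> z \<le> b})"

definition tangent_cone :: "(real \<times> real) set \<Rightarrow> real \<times> real \<Rightarrow> (real \<times> real) set" where
  "tangent_cone \<Omega> \<xi> = \<Inter> {{z. a \<bullet> z \<le> b} | a b.
     a \<noteq> 0 \<and> \<Omega> \<subseteq> {z. a \<bullet> z \<le> b} \<and> support_line \<Omega> {z. a \<bullet> z = b} \<and> a \<bullet> \<xi> = b}"

definition singular_point :: "(real \<times> real) set \<Rightarrow> real \<times> real \<Rightarrow> bool" where
  "singular_point \<Omega> \<xi> \<longleftrightarrow> \<xi> \<in> frontier \<Omega> \<and>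
     (\<exists>L L'. L \<noteq> L' \<and> support_line \<Omega> L \<and> \<xi> \<in> L \<and> support_line \<Omega> L' \<and> \<xi> \<in> L')"

definition angular_support_line :: "(real \<times> real) set \<Rightarrow> (real \<times> real) set \<Rightarrow> bool" where
  "angular_support_line \<Omega> L \<longleftrightarrow>
     is_line L \<and> (\<exists>\<xi>. singular_point \<Omega> \<xi> \<and> L \<inter> tangent_cone \<Omega> \<xi> = {\<xi>})"

end

theory Submission
  imports Defs
begin

text \<open>
  Write \<open>E\<^sub>x\<close> and \<open>E\<^sub>y\<close> for the integrals of \<open>\<bar>u\<^sub>x\<bar> powr p\<close> and \<open>\<bar>u\<^sub>y\<bar> powr p\<close>. The supremum \<open>K p \<Omega>\<close> is finite
  exactly when \<open>E\<^sub>x \<le> k * E\<^sub>y\<close> holds with one constant \<open>k\<close> for all admissible \<open>u\<close> (\<open>K_finite_iff\<close>).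

  Suppose that both vertical support lines are angular. Then they touch \<open>\<Omega>\<close> at points \<open>A\<close> and \<open>B\<close>, and
  \<open>\<Omega>\<close> lies in a cone with vertex \<open>A\<close> opening to the right and in a cone with vertex \<open>B\<close> opening to the
  left, both of some slope \<open>M\<close>. The tangent plane of \<open>u\<close> at an interior point is nonnegative at \<open>A\<close> and at
  \<open>B\<close>; reading this off gives \<open>\<bar>u\<^sub>x\<bar> \<le> \<bar>u\<bar> / d + M * \<bar>u\<^sub>y\<bar>\<close>, where \<open>d\<close> is the smaller of the horizontal
  distances to \<open>A\<close> and \<open>B\<close>. A vertical slice has length at most \<open>2 * M * d\<close> and \<open>u\<close> vanishes at its ends,
  so the one-dimensional Poincare inequality bounds the integral of \<open>(\<bar>u\<bar> / d) powr p\<close> over the slice by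
  \<open>(2 * M) powr p\<close> times that of \<open>\<bar>u\<^sub>y\<bar> powr p\<close>. Integration over the slices gives \<open>energy_x_le_energy_y\<close>.

  Suppose that one of the lines is not angular. Then for every \<open>h > 0\<close> there is a chord \<open>AB\<close> of \<open>\<Omega>\<close> whose
  end points are within \<open>h\<close> times its height from the line (\<open>not_angular_imp_steep\<close>), so the boundary arc
  next to its middle half has nearly horizontal normals. Take for \<open>u\<close> the largest function below all
  affine functions that are nonnegative on \<open>\<Omega>\<close>, vanish on a support line, and have slope \<open>N\<close> if the normal
  is nearly horizontal and slope about 1 otherwise. Its gradients satisfy \<open>\<bar>u\<^sub>y\<bar> \<le> s * \<bar>u\<^sub>x\<bar> + 1 + s\<close> with
  \<open>s = 8 * h\<close>, while on each row through the middle half \<open>u\<close> climbs to a height \<open>c\<close> that does not depend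
  on \<open>N\<close> within a distance \<open>c / N\<close> of the arc. Hence \<open>E\<^sub>x\<close> is at least a constant times \<open>N powr (p - 1)\<close>,
  which tends to infinity, and \<open>E\<^sub>y / E\<^sub>x\<close> is eventually at most of the order of \<open>s powr p\<close>
  (\<open>ratio_unbounded\<close>). As \<open>h\<close> is arbitrary, no constant \<open>k\<close> works.

  Both parts need that a concave function has partial derivatives almost everywhere and that they
  integrate back to increments along segments. The one-sided derivatives give this: along every line
  they exist, are monotone, and are supergradients.
\<close>

section \<open>One-sided derivatives of concave functions\<close>

text \<open>
  One-sided derivative of \<open>u\<close> at \<open>z\<close> in the direction \<open>e\<close>. A limit along a sequence is used because it is
  Borel measurable in \<open>z\<close> whenever \<open>u\<close> is.
\<close>
definition dir_deriv :: "('a::real_vector \<Rightarrow> real) \<Rightarrow> 'a \<Rightarrow> 'a \<Rightarrow> real" where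
  "dir_deriv u e z = lim (\<lambda>n. (u (z + inverse (real (Suc n)) *\<^sub>R e) - u z) / inverse (real (Suc n)))"

lemma concave_slope_antimono:
  fixes v :: "real \<Rightarrow> real"
  assumes v: "concave_on S v" and "x \<in> S" "z \<in> S" "x < y" "y < z"
  shows "(v z - v x) / (z - x) \<le> (v y - v x) / (y - x)"
    and "(v z - v y) / (z - y) \<le> (v z - v x) / (z - x)"
proof -
  have c: "convex_on S (\<lambda>x. - v x)" using v by (simp add: concave_on_def)
  note s = convex_on_slope_le[OF c assms(2-5)]
  show "(v z - v x) / (z - x) \<le> (v y - v x) / (y - x)"
    using s(1) assms(4,5) by (simp add: divide_simps split: if_splits) (simp add: algebra_simps)
  show "(v z - v y) / (z - y) \<le> (v z - v x) / (z - x)"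
    using s(2) assms(4,5) by (simp add: divide_simps split: if_splits) (simp add: algebra_simps)
qed

text \<open>
  Slopes of chords starting at \<open>t\<close> increase as the chord shrinks and are bounded by any slope to the left
  of \<open>t\<close>. So they converge to their supremum, which lies between the slopes on the two sides.
\<close>
lemma concave_right_derivative:
  fixes v :: "real \<Rightarrow> real"
  assumes v: "concave_on S v" and S: "open S" and t: "t \<in> S"
  obtains r where "((\<lambda>h. (v (t + h) - v t) / h) \<longlongrightarrow> r) (at_right 0)"
    and "\<And>t'. t' \<in> S \<Longrightarrow> v t' \<le> v t + r * (t' - t)"
proof -
  define q where "q = (\<lambda>h. (v (t + h) - v t) / h)"
  define H where "H = {h. 0 < h \<and> t + h \<in> S}"
  define r where "r = Sup (q ` H)"
  obtain e where e: "e > 0" "ball t e \<subseteq> S" using S t openE by blast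
  have cv: "convex S" using v by (rule concave_on_imp_convex)
  have sub: "h' \<in> H" if "h \<in> H" "0 < h'" "h' \<le> h" for h h'
  proof -
    have "t + h' \<in> closed_segment t (t + h)" using that by (auto simp: closed_segment_eq_real_ivl)
    then show ?thesis using that t cv by (auto simp: H_def convex_contains_segment)
  qed
  have bound: "q h \<le> (v t - v t') / (t - t')" if "h \<in> H" "t' \<in> S" "t' < t" for h t'
  proof -
    have "q h \<le> (v (t + h) - v t') / (t + h - t')"
      using concave_slope_antimono(2)[OF v, of t' "t + h" t] that by (auto simp: H_def q_def)
    also have "\<dots> \<le> (v t - v t') / (t - t')"
      using concave_slope_antimono(1)[OF v, of t' "t + h" t] that by (auto simp: H_def)
    finally show ?thesis .
  qed
  have eH: "e / 2 \<in> H" and eS: "t - e / 2 \<in> S" using e by (auto simp: H_def dist_real_def subset_iff)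
  have bdd: "bdd_above (q ` H)"
    using bound[OF _ eS] e by (auto intro!: bdd_aboveI2)
  have le_r: "q h \<le> r" if "h \<in> H" for h
    unfolding r_def using that bdd by (intro cSup_upper) auto
  have anti: "q h \<le> q h'" if "h \<in> H" "0 < h'" "h' \<le> h" for h h'
  proof (cases "h' = h")
    case False
    then show ?thesis
      using concave_slope_antimono(1)[OF v t, of "t + h" "t + h'"] that by (auto simp: H_def q_def)
  qed auto
  have "(q \<longlongrightarrow> r) (at_right 0)"
  proof (rule tendstoI)
    fix \<epsilon> :: real assume "\<epsilon> > 0"
    then obtain h where h: "h \<in> H" "q h > r - \<epsilon>"
      using eH less_cSup_iff[of "q ` H" "r - \<epsilon>"] bdd by (auto simp: r_def)
    have "\<forall>\<^sub>F h' in at_right 0. h' \<in> {0<..<h}"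
      using h by (intro eventually_at_right_real) (auto simp: H_def)
    then show "\<forall>\<^sub>F x in at_right 0. dist (q x) r < \<epsilon>"
    proof eventually_elim
      case (elim h')
      then have "q h \<le> q h'" "q h' \<le> r" using anti[OF h(1)] le_r sub[OF h(1)] by auto
      then show ?case using h by (auto simp: dist_real_def)
    qed
  qed
  moreover have "v t' \<le> v t + r * (t' - t)" if "t' \<in> S" for t'
  proof (cases t' t rule: linorder_cases)
    case less
    have "r \<le> (v t - v t') / (t - t')"
      unfolding r_def using eH bound[OF _ that less] by (intro cSup_least) auto
    then show ?thesis using less by (simp add: field_simps)
  next
    case greater
    then have "q (t' - t) \<le> r" using that by (intro le_r) (auto simp: H_def)
    then show ?thesis using greater by (simp add: q_def field_simps)
  qed auto
  ultimately show ?thesis using that unfolding q_def by blast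
qed

lemma filterlim_inverse_Suc: "filterlim (\<lambda>n. inverse (real (Suc n))) (at_right 0) sequentially"
  unfolding at_within_def filterlim_inf filterlim_principal
  using LIMSEQ_inverse_real_of_nat by (auto simp: eventually_sequentially)

lemma dir_deriv_eqI:
  assumes "((\<lambda>h. (u (z + h *\<^sub>R e) - u z) / h) \<longlongrightarrow> r) (at_right 0)"
  shows "dir_deriv u e z = r"
  unfolding dir_deriv_def
  using filterlim_compose[OF assms filterlim_inverse_Suc] by (intro limI) simp

locale concave_fun =
  fixes S :: "'a::euclidean_space set" and u :: "'a \<Rightarrow> real"
  assumes open_S: "open S" and concave: "concave_on S u"
begin

definition line :: "'a \<Rightarrow> 'a \<Rightarrow> real set" where "line e z = {t. z + t *\<^sub>R e \<in> S}"

lemma open_line: "open (line e z)"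
proof -
  have "open ((\<lambda>t. z + t *\<^sub>R e) -` S)" by (intro open_vimage open_S continuous_intros)
  then show ?thesis by (simp add: line_def vimage_def)
qed

lemma concave_line: "concave_on (line e z) (\<lambda>t. u (z + t *\<^sub>R e))"
proof -
  have eq: "z + ((1 - a) * x + a * y) *\<^sub>R e = (1 - a) *\<^sub>R (z + x *\<^sub>R e) + a *\<^sub>R (z + y *\<^sub>R e)"
    for a x y by (simp add: algebra_simps)
  have cS: "convex S" using concave by (rule concave_on_imp_convex)
  have "z + ((1 - a) * x + a * y) *\<^sub>R e \<in> S"
    if "z + x *\<^sub>R e \<in> S" "z + y *\<^sub>R e \<in> S" "0 \<le> a" "a \<le> 1" for a x y
    using convexD_alt[OF cS that(1,2), of a] that unfolding eq by auto
  then have "convex (line e z)" unfolding convex_alt line_def by (auto simp: algebra_simps)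
  then show ?thesis
  proof (rule concave_on_linorderI[rotated])
    fix a x y :: real assume "0 < a" "a < 1" "x \<in> line e z" "y \<in> line e z"
    then show "u (z + ((1 - a) *\<^sub>R x + a *\<^sub>R y) *\<^sub>R e)
        \<ge> (1 - a) * u (z + x *\<^sub>R e) + a * u (z + y *\<^sub>R e)"
      using concave_onD[OF concave, of a "z + x *\<^sub>R e" "z + y *\<^sub>R e"] by (simp add: eq line_def)
  qed
qed

lemma dir_deriv_tendsto:
  assumes z: "z \<in> S"
  shows "((\<lambda>h. (u (z + h *\<^sub>R e) - u z) / h) \<longlongrightarrow> dir_deriv u e z) (at_right 0)"
    and "z + t *\<^sub>R e \<in> S \<Longrightarrow> u (z + t *\<^sub>R e) \<le> u z + dir_deriv u e z * t"
proof -
  have 0: "0 \<in> line e z" using z by (simp add: line_def)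
  obtain r where r: "((\<lambda>h. (u (z + (0 + h) *\<^sub>R e) - u (z + 0 *\<^sub>R e)) / h) \<longlongrightarrow> r) (at_right 0)"
    "\<And>t'. t' \<in> line e z \<Longrightarrow> u (z + t' *\<^sub>R e) \<le> u (z + 0 *\<^sub>R e) + r * (t' - 0)"
    using concave_right_derivative[OF concave_line open_line 0] by blast
  from r(1) have "dir_deriv u e z = r" by (intro dir_deriv_eqI) simp
  with r show "((\<lambda>h. (u (z + h *\<^sub>R e) - u z) / h) \<longlongrightarrow> dir_deriv u e z) (at_right 0)"
    "z + t *\<^sub>R e \<in> S \<Longrightarrow> u (z + t *\<^sub>R e) \<le> u z + dir_deriv u e z * t"
    by (auto simp: line_def)
qed

text \<open>
  For concave \<open>u\<close> this says that the two-sided derivative in the direction \<open>e\<close> exists; in this form the set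
  is visibly Borel.
\<close>
definition smooth_pts :: "'a \<Rightarrow> 'a set" where
  "smooth_pts e = {z \<in> S. dir_deriv u e z = - dir_deriv u (- e) z}"

lemma smooth_pts_derivative:
  assumes "z \<in> smooth_pts e"
  shows "((\<lambda>t. u (z + t *\<^sub>R e)) has_real_derivative dir_deriv u e z) (at 0)"
proof -
  have z: "z \<in> S" and eq: "dir_deriv u e z = - dir_deriv u (- e) z"
    using assms by (auto simp: smooth_pts_def)
  have "((\<lambda>h. - ((u (z + h *\<^sub>R (-e)) - u z) / h)) \<longlongrightarrow> - dir_deriv u (- e) z) (at_right 0)"
    by (intro tendsto_minus dir_deriv_tendsto z)
  then have "((\<lambda>h. (u (z + h *\<^sub>R e) - u z) / h) \<longlongrightarrow> dir_deriv u e z) (at_left 0)"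
    by (simp add: at_left_minus filterlim_filtermap eq)
  with dir_deriv_tendsto(1)[OF z, of e]
  show ?thesis unfolding DERIV_def by (simp add: filterlim_split_at)
qed

text \<open>
  Along a line the one-sided derivatives \<open>D\<close> (forward) and \<open>L\<close> (backward) decrease and interlace, so they
  agree wherever the monotone function \<open>D\<close> is continuous.
\<close>
lemma countable_not_smooth: "countable {t. z + t *\<^sub>R e \<in> S - smooth_pts e}"
proof -
  define D where "D t = dir_deriv u e (z + t *\<^sub>R e)" for t
  define L where "L t = - dir_deriv u (- e) (z + t *\<^sub>R e)" for t
  have D: "u (z + t' *\<^sub>R e) \<le> u (z + t *\<^sub>R e) + D t * (t' - t)"
    if "t \<in> line e z" "t' \<in> line e z" for t t'
    using dir_deriv_tendsto(2)[of "z + t *\<^sub>R e" "t' - t" e] that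
    by (simp add: line_def D_def algebra_simps)
  have L: "u (z + t' *\<^sub>R e) \<le> u (z + t *\<^sub>R e) + L t * (t' - t)"
    if "t \<in> line e z" "t' \<in> line e z" for t t'
    using dir_deriv_tendsto(2)[of "z + t *\<^sub>R e" "- (t' - t)" "- e"] that
    by (simp add: line_def L_def algebra_simps)
  have DL: "D s \<ge> L t" "D s \<ge> D t" if "s \<in> line e z" "t \<in> line e z" "s < t" for s t
  proof -
    have "0 \<le> (D s - L t) * (t - s)" using D[of s t] L[of t s] that by (simp add: algebra_simps)
    then show "D s \<ge> L t" using that by (simp add: zero_le_mult_iff)
    have "0 \<le> (D s - D t) * (t - s)" using D[of s t] D[of t s] that by (simp add: algebra_simps)
    then show "D s \<ge> D t" using that by (simp add: zero_le_mult_iff)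
  qed
  have LD: "L t \<ge> D t" if t: "t \<in> line e z" for t
  proof -
    obtain \<epsilon> where "\<epsilon> > 0" "ball t \<epsilon> \<subseteq> line e z" using open_line t openE by blast
    then have s: "t + \<epsilon>/2 \<in> line e z" "t - \<epsilon>/2 \<in> line e z" by (auto simp: dist_real_def subset_iff)
    let ?T = "z + t *\<^sub>R e"
    have *: "?T \<in> S" using t by (simp add: line_def)
    have l: "((\<lambda>h. (u (?T + h *\<^sub>R e) - u ?T) / h) \<longlongrightarrow> D t) (at_right 0)"
      unfolding D_def by (rule dir_deriv_tendsto[OF *])
    have "\<forall>\<^sub>F h in at_right 0. h \<in> {0<..<\<epsilon>}"
      using \<open>\<epsilon> > 0\<close> by (intro eventually_at_right_real) auto
    then have "\<forall>\<^sub>F h in at_right 0. (u (?T + h *\<^sub>R e) - u ?T) / h \<le> L t"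
    proof eventually_elim
      case (elim h)
      then have "t + h \<in> line e z" using \<open>ball t \<epsilon> \<subseteq> line e z\<close> by (auto simp: dist_real_def subset_iff)
      with L[OF t this] elim show ?case by (simp add: field_simps)
    qed
    then show ?thesis using tendsto_upperbound[OF l] by simp
  qed
  have "mono_on (line e z) (\<lambda>t. - D t)"
    by (intro mono_onI) (use DL(2) in \<open>force simp: le_less\<close>)
  then have "countable {t \<in> line e z. \<not> continuous (at t within line e z) (\<lambda>t. - D t)}"
    by (rule mono_on_ctble_discont)
  moreover have "D t = L t" if t: "t \<in> line e z" and cont: "continuous (at t within line e z) (\<lambda>t. - D t)" for t
  proof (rule antisym[OF LD[OF t]])
    have "continuous (at t) D"
      using continuous_minus[OF cont] at_within_open[OF t open_line] by simp
    then have l: "(D \<longlongrightarrow> D t) (at_left t)"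
      unfolding continuous_at using filterlim_at_split by blast
    obtain \<epsilon> where "\<epsilon> > 0" "ball t \<epsilon> \<subseteq> line e z" using open_line t openE by blast
    then have "\<forall>\<^sub>F s in at_left t. s \<in> {t - \<epsilon><..<t}"
      by (intro eventually_at_left_real) auto
    then have "\<forall>\<^sub>F s in at_left t. L t \<le> D s"
    proof eventually_elim
      case (elim s)
      then have "s \<in> line e z" using \<open>ball t \<epsilon> \<subseteq> line e z\<close> by (auto simp: dist_real_def subset_iff)
      with DL(1)[OF this t] elim show ?case by simp
    qed
    then show "L t \<le> D t" using tendsto_lowerbound[OF l] by simp
  qed
  ultimately show ?thesis
    by (elim countable_subset[rotated]) (auto simp: line_def smooth_pts_def D_def L_def)
qed

end

section \<open>Energy on a segment\<close>

text \<open>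
  Bisection: each halving of the interval halves the bound, because the decrements of \<open>D\<close> add up.
\<close>
lemma antitone_increment_const:
  fixes w D :: "real \<Rightarrow> real"
  assumes w: "\<And>s t. a \<le> s \<Longrightarrow> s \<le> t \<Longrightarrow> t \<le> b \<Longrightarrow> \<bar>w t - w s\<bar> \<le> (D s - D t) * (t - s)"
    and ab: "a \<le> b"
  shows "w b = w a"
proof -
  have halve: "\<bar>w t - w s\<bar> \<le> (D s - D t) * (t - s) / 2 ^ k"
    if "a \<le> s" "s \<le> t" "t \<le> b" for s t k
    using that
  proof (induction k arbitrary: s t)
    case 0
    then show ?case using w by simp
  next
    case (Suc k)
    let ?m = "(s + t) / 2"
    have "\<bar>w ?m - w s\<bar> \<le> (D s - D ?m) * (?m - s) / 2 ^ k" using Suc.prems by (intro Suc.IH) auto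
    moreover have "\<bar>w t - w ?m\<bar> \<le> (D ?m - D t) * (t - ?m) / 2 ^ k" using Suc.prems by (intro Suc.IH) auto
    ultimately have "\<bar>w t - w s\<bar> \<le> (D s - D ?m) * (?m - s) / 2 ^ k + (D ?m - D t) * (t - ?m) / 2 ^ k" by linarith
    also have "\<dots> = (D s - D t) * (t - s) / 2 ^ Suc k" by (simp add: field_simps)
    finally show ?case .
  qed
  have "(\<lambda>k. (D a - D b) * (b - a) * (1/2) ^ k) \<longlonglongrightarrow> (D a - D b) * (b - a) * 0"
    by (intro tendsto_intros LIMSEQ_power_zero) auto
  then have "\<bar>w b - w a\<bar> \<le> 0"
    using halve[of a b] ab by (intro tendsto_lowerbound[where f="\<lambda>k. (D a - D b) * (b - a) * (1/2) ^ k"])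
      (auto simp: field_simps)
  then show ?thesis by simp
qed

text \<open>
  Fundamental theorem for concave functions. Both \<open>v\<close> and the integral of \<open>D\<close> have increments
  between \<open>D t * (t - s)\<close> and \<open>D s * (t - s)\<close>, so \<open>antitone_increment_const\<close> applies to their
  difference.
\<close>
lemma supergradient_has_integral:
  fixes v D :: "real \<Rightarrow> real"
  assumes D: "\<And>s t. s \<in> {a..b} \<Longrightarrow> t \<in> {a..b} \<Longrightarrow> v t \<le> v s + D s * (t - s)" and ab: "a \<le> b"
  shows "(D has_integral (v b - v a)) {a..b}"
proof -
  have anti: "D t \<le> D s" if "s \<in> {a..b}" "t \<in> {a..b}" "s \<le> t" for s t
  proof (cases "s = t")
    case False
    have "0 \<le> (D s - D t) * (t - s)" using D[of s t] D[of t s] that by (simp add: algebra_simps)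
    then show ?thesis using False that by (simp add: zero_le_mult_iff)
  qed auto
  have "(\<lambda>t. - D t) integrable_on {a..b}"
    by (intro integrable_on_mono_on mono_onI) (use anti in auto)
  then have int: "D integrable_on {a..b}" using integrable_neg_iff by blast
  define w where "w t = v t - integral {a..t} D" for t
  have "w b = w a"
  proof (rule antitone_increment_const[where D=D, OF _ ab])
    fix s t assume st: "a \<le> s" "s \<le> t" "t \<le> b"
    have i: "D integrable_on {s..t}" by (rule integrable_subinterval_real[OF int]) (use st in auto)
    have "D t * (t - s) \<le> integral {s..t} D" "integral {s..t} D \<le> D s * (t - s)"
      using has_integral_le[OF has_integral_const_real[of "D t" s t] integrable_integral[OF i]]
        has_integral_le[OF integrable_integral[OF i] has_integral_const_real[of "D s" s t]]
        anti st by (auto simp: mult.commute)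
    moreover have "integral {a..t} D = integral {a..s} D + integral {s..t} D"
      using st by (intro Henstock_Kurzweil_Integration.integral_combine[symmetric] integrable_subinterval_real[OF int]) auto
    moreover have "v t \<le> v s + D s * (t - s)" "v s \<le> v t - D t * (t - s)"
      using D[of s t] D[of t s] st by (auto simp: algebra_simps)
    ultimately show "\<bar>w t - w s\<bar> \<le> (D s - D t) * (t - s)"
      unfolding w_def by (simp add: algebra_simps abs_le_iff)
  qed
  then have "integral {a..b} D = v b - v a" by (simp add: w_def)
  then show ?thesis using int has_integral_integral by metis
qed

lemma powr_above_tangent:
  fixes x c p :: real
  assumes "0 \<le> x" "0 < c" "1 \<le> p"
  shows "c powr p + p * c powr (p - 1) * (x - c) \<le> x powr p"
proof (cases "x = 0")
  case True
  have "c powr (p - 1) * c = c powr p" using assms by (simp add: powr_diff)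
  then have "c powr p + p * c powr (p - 1) * (0 - c) = (1 - p) * c powr p" by (simp add: algebra_simps)
  also have "\<dots> \<le> 0" using assms by (simp add: mult_nonpos_nonneg)
  finally show ?thesis using True assms by simp
next
  case False
  have "((\<lambda>x. x powr p) has_real_derivative p * c powr (p - 1)) (at c within {0<..})"
    using assms by (auto intro!: derivative_eq_intros)
  from convex_on_imp_above_tangent[OF powr_convex[OF assms(3)] _ _ _ this, of x]
  show ?thesis using assms False by (simp add: algebra_simps interior_open)
qed

text \<open>
  Jensen's inequality for \<open>\<lambda>x. x powr p\<close>: among all functions with a given increment over the interval
  the affine one has the least energy. It is proved by integrating the tangent line at the average slope.
\<close>
lemma slice_energy_closed:
  fixes v D :: "real \<Rightarrow> real"
  assumes D: "\<And>s t. s \<in> {a..b} \<Longrightarrow> t \<in> {a..b} \<Longrightarrow> v t \<le> v s + D s * (t - s)" and ab: "a < b"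
    and p: "1 \<le> p" and [measurable]: "D \<in> borel_measurable borel"
  shows "ennreal (\<bar>v b - v a\<bar> powr p * (b - a) powr (1 - p))
    \<le> (\<integral>\<^sup>+t. ennreal (\<bar>D t\<bar> powr p) * indicator {a..b} t \<partial>lborel)" (is "_ \<le> ?F")
proof (cases "?F = \<infinity> \<or> v b = v a")
  case True
  then show ?thesis using p by auto
next
  case False
  define \<Delta> where "\<Delta> = \<bar>v b - v a\<bar>"
  define c where "c = \<Delta> / (b - a)"
  define \<sigma> where "\<sigma> = sgn (v b - v a)"
  have \<Delta>: "\<Delta> > 0" and c: "c > 0" using False ab by (auto simp: \<Delta>_def c_def)
  obtain r where r: "?F = ennreal r" "r \<ge> 0" using False by (cases ?F) auto
  have F: "?F = (\<integral>\<^sup>+t. ennreal (\<bar>D t\<bar> powr p * indicator {a..b} t) \<partial>lborel)"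
    by (intro nn_integral_cong) (auto simp: indicator_def)
  have "((\<lambda>t. \<bar>D t\<bar> powr p * indicator {a..b} t) has_integral r) UNIV"
    by (rule nn_integral_has_integral) (use r F in auto)
  then have ub: "((\<lambda>t. \<bar>D t\<bar> powr p) has_integral r) {a..b}"
    by (subst has_integral_restrict_UNIV[symmetric])
       (simp add: indicator_def of_bool_def if_distrib cong: if_cong)
  have I: "(D has_integral (v b - v a)) {a..b}"
    using supergradient_has_integral[OF D] ab by simp
  have "((\<lambda>t. c powr p + p * c powr (p - 1) * (\<sigma> * D t - c)) has_integral
      ((b - a) * c powr p + p * c powr (p - 1) * (\<sigma> * (v b - v a) - (b - a) * c))) {a..b}"
    using has_integral_const_real[of "c powr p" a b] has_integral_const_real[of c a b] ab
    by (intro has_integral_add has_integral_mult_right has_integral_diff I) auto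
  moreover have "c powr p + p * c powr (p - 1) * (\<sigma> * D t - c) \<le> \<bar>D t\<bar> powr p" for t
  proof -
    have "\<sigma> * D t \<le> \<bar>D t\<bar>" unfolding \<sigma>_def by (auto simp: sgn_if)
    then have "p * c powr (p - 1) * (\<sigma> * D t - c) \<le> p * c powr (p - 1) * (\<bar>D t\<bar> - c)"
      using p by (intro mult_left_mono) auto
    then show ?thesis using powr_above_tangent[of "\<bar>D t\<bar>" c p] c p by linarith
  qed
  ultimately have "(b - a) * c powr p + p * c powr (p - 1) * (\<sigma> * (v b - v a) - (b - a) * c) \<le> r"
    using has_integral_le[OF _ ub] by blast
  moreover have "\<sigma> * (v b - v a) = \<Delta>" by (simp add: \<sigma>_def \<Delta>_def abs_sgn mult.commute)
  moreover have "(b - a) * c = \<Delta>" using ab by (simp add: c_def)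
  ultimately have "(b - a) * c powr p \<le> r" by simp
  moreover have "(b - a) * c powr p = \<Delta> powr p * (b - a) powr (1 - p)"
    using ab \<Delta> by (simp add: c_def powr_divide powr_diff)
  ultimately show ?thesis using r by (simp add: \<Delta>_def ennreal_leI)
qed

text \<open>
  At the end points \<open>v\<close> may have no finite supergradient, so \<open>slice_energy_closed\<close> is applied to
  intervals that exhaust the open one.
\<close>
lemma slice_energy:
  fixes v D :: "real \<Rightarrow> real"
  assumes D: "\<And>s t. s \<in> {a<..<b} \<Longrightarrow> t \<in> {a<..<b} \<Longrightarrow> v t \<le> v s + D s * (t - s)" and ab: "a < b"
    and cont: "continuous_on {a..b} v"
    and p: "1 \<le> p" and [measurable]: "D \<in> borel_measurable borel"
  shows "ennreal (\<bar>v b - v a\<bar> powr p * (b - a) powr (1 - p))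
    \<le> (\<integral>\<^sup>+t. ennreal (\<bar>D t\<bar> powr p) * indicator {a<..<b} t \<partial>lborel)" (is "_ \<le> ?F")
proof -
  define h where "h n = (b - a) * inverse (real (Suc (Suc (Suc n))))" for n
  define s where "s n = a + h n" for n
  define t where "t n = b - h n" for n
  have h: "0 < h n" "h n \<le> (b - a) / 3" for n
    unfolding h_def using ab by (auto simp: field_simps intro!: mult_right_mono)
  have h0: "h \<longlonglongrightarrow> (b - a) * 0"
    unfolding h_def by (intro tendsto_mult tendsto_const)
      (use LIMSEQ_Suc[OF LIMSEQ_Suc[OF LIMSEQ_inverse_real_of_nat]] in simp)
  have st: "s \<longlonglongrightarrow> a" "t \<longlonglongrightarrow> b" unfolding s_def t_def
    using tendsto_add[OF tendsto_const[of a] h0] tendsto_diff[OF tendsto_const[of b] h0] by auto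
  have ord: "a < s n" "s n < t n" "t n < b" for n
    using h[of n] ab unfolding s_def t_def by auto
  have vs: "(\<lambda>n. v (s n)) \<longlonglongrightarrow> v a"
    by (rule continuous_on_tendsto_compose[OF cont st(1)])
       (use ord ab in \<open>auto intro!: eventuallyI less_imp_le intro: less_trans\<close>)
  have vt: "(\<lambda>n. v (t n)) \<longlonglongrightarrow> v b"
    by (rule continuous_on_tendsto_compose[OF cont st(2)])
       (use ord ab in \<open>auto intro!: eventuallyI less_imp_le intro: less_trans\<close>)
  have lim: "(\<lambda>n. ennreal (\<bar>v (t n) - v (s n)\<bar> powr p * (t n - s n) powr (1 - p)))
      \<longlonglongrightarrow> ennreal (\<bar>v b - v a\<bar> powr p * (b - a) powr (1 - p))"
    by (intro tendsto_ennrealI tendsto_mult tendsto_powr2 tendsto_powr tendsto_rabs tendsto_diff vs vt st tendsto_const)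
       (use ab p in auto)
  have "ennreal (\<bar>v (t n) - v (s n)\<bar> powr p * (t n - s n) powr (1 - p)) \<le> ?F" for n
  proof -
    have "ennreal (\<bar>v (t n) - v (s n)\<bar> powr p * (t n - s n) powr (1 - p))
        \<le> (\<integral>\<^sup>+x. ennreal (\<bar>D x\<bar> powr p) * indicator {s n..t n} x \<partial>lborel)"
      using ord[of n] by (intro slice_energy_closed D p) auto
    also have "\<dots> \<le> ?F"
      using ord[of n] by (intro nn_integral_mono) (auto simp: indicator_def)
    finally show ?thesis .
  qed
  then show ?thesis by (intro LIMSEQ_le_const2[OF lim]) blast
qed

context concave_fun
begin

text \<open>
  The extension by 0 makes this a Borel function on the whole space, so that energies are integrals over
  the whole space.
\<close>
definition pd :: "'a \<Rightarrow> 'a \<Rightarrow> real" where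
  "pd e z = (if z \<in> S then dir_deriv u e z else 0)"

lemma borel_measurable_pd [measurable]: "pd e \<in> borel_measurable borel"
proof -
  have [measurable]: "S \<in> sets borel" using open_S by simp
  have cont: "continuous_on S u"
    using convex_on_continuous[OF open_S] concave continuous_on_minus[of S "\<lambda>x. - u x"]
    by (auto simp: concave_on_def)
  define w where "w = (\<lambda>z. if z \<in> S then u z else 0)"
  have [measurable]: "w \<in> borel_measurable borel"
    unfolding w_def by (intro borel_measurable_continuous_on_if cont continuous_on_const) auto
  have eq: "dir_deriv w e z = dir_deriv u e z" if z: "z \<in> S" for z
  proof (rule dir_deriv_eqI)
    have "\<forall>\<^sub>F h in at_right 0. z + h *\<^sub>R e \<in> S"
    proof -
      have "0 \<in> line e z" using z by (simp add: line_def)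
      then have "\<forall>\<^sub>F h in at 0. h \<in> line e z"
        by (rule eventually_at_in_open'[OF open_line])
      then show ?thesis by (simp add: eventually_at_split line_def)
    qed
    then have "\<forall>\<^sub>F h in at_right 0. (u (z + h *\<^sub>R e) - u z) / h = (w (z + h *\<^sub>R e) - w z) / h"
      by eventually_elim (use z in \<open>auto simp: w_def\<close>)
    then show "((\<lambda>h. (w (z + h *\<^sub>R e) - w z) / h) \<longlongrightarrow> dir_deriv u e z) (at_right 0)"
      by (rule Lim_transform_eventually[OF dir_deriv_tendsto(1)[OF z]])
  qed
  have "(\<lambda>z. dir_deriv w e z) \<in> borel_measurable borel"
    unfolding dir_deriv_def by measurable
  then have "(\<lambda>z. if z \<in> S then dir_deriv w e z else 0) \<in> borel_measurable borel"
    by measurable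
  also have "(\<lambda>z. if z \<in> S then dir_deriv w e z else 0) = pd e"
    by (auto simp: pd_def eq)
  finally show ?thesis .
qed

lemma smooth_pts_pd: "z \<in> smooth_pts e \<longleftrightarrow> z \<in> S \<and> pd e z = - pd (- e) z"
  by (auto simp: smooth_pts_def pd_def)

lemma smooth_pts_borel [measurable]: "smooth_pts e \<in> sets borel"
proof -
  have [measurable]: "S \<in> sets borel" using open_S by simp
  have "smooth_pts e = {z \<in> space borel. z \<in> S \<and> pd e z = - pd (- e) z}"
    by (auto simp: smooth_pts_pd)
  also have "\<dots> \<in> sets borel" by measurable
  finally show ?thesis .
qed

lemma segment_energy:
  assumes "a < b" "1 \<le> p"
    and cont: "continuous_on {a..b} (\<lambda>t. u (z + t *\<^sub>R e))"
    and S: "\<And>t. a < t \<Longrightarrow> t < b \<Longrightarrow> z + t *\<^sub>R e \<in> S"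
  shows "ennreal (\<bar>u (z + b *\<^sub>R e) - u (z + a *\<^sub>R e)\<bar> powr p * (b - a) powr (1 - p))
    \<le> (\<integral>\<^sup>+t. ennreal (\<bar>pd e (z + t *\<^sub>R e)\<bar> powr p) \<partial>lborel)"
proof -
  have "ennreal (\<bar>u (z + b *\<^sub>R e) - u (z + a *\<^sub>R e)\<bar> powr p * (b - a) powr (1 - p))
    \<le> (\<integral>\<^sup>+t. ennreal (\<bar>pd e (z + t *\<^sub>R e)\<bar> powr p) * indicator {a<..<b} t \<partial>lborel)"
  proof (rule slice_energy[OF _ assms(1) cont assms(2)])
    fix s t assume "s \<in> {a<..<b}" "t \<in> {a<..<b}"
    then show "u (z + t *\<^sub>R e) \<le> u (z + s *\<^sub>R e) + pd e (z + s *\<^sub>R e) * (t - s)"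
      using S[of s] S[of t] dir_deriv_tendsto(2)[of "z + s *\<^sub>R e" "t - s" e]
      by (simp add: pd_def algebra_simps)
  qed measurable
  also have "\<dots> \<le> (\<integral>\<^sup>+t. ennreal (\<bar>pd e (z + t *\<^sub>R e)\<bar> powr p) \<partial>lborel)"
    by (intro nn_integral_mono) (auto simp: indicator_def)
  finally show ?thesis .
qed

definition energy :: "real \<Rightarrow> 'a \<Rightarrow> ennreal" where
  "energy p e = (\<integral>\<^sup>+z. ennreal (\<bar>pd e z\<bar> powr p) \<partial>lborel)"

end

section \<open>Concave functions in the plane\<close>

lemma first_order:
  assumes "((\<lambda>t. f (a + t)) has_real_derivative D) (at 0)" "\<epsilon> > 0"
  obtains d where "d > 0" "\<And>t. \<bar>t\<bar> < d \<Longrightarrow> \<bar>f (a + t) - f a - D * t\<bar> \<le> \<epsilon> * \<bar>t\<bar>"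
proof -
  have "((\<lambda>t. f (a + t)) has_derivative (*) D) (at 0)"
    using assms(1) by (simp add: has_field_derivative_def)
  then obtain d where "d > 0" "\<And>t. \<bar>t\<bar> < d \<Longrightarrow> \<bar>f (a + t) - f a - D * t\<bar> \<le> \<epsilon> * \<bar>t\<bar>"
    using assms(2) unfolding has_derivative_at_alt by (auto simp: real_norm_def)
  then show ?thesis using that by blast
qed

locale concave_plane = concave_fun S u for S :: "(real \<times> real) set" and u
begin

lemma AE_smooth_x: "AE z in lborel. z \<in> S \<longrightarrow> z \<in> smooth_pts (1, 0)"
  and AE_smooth_y: "AE z in lborel. z \<in> S \<longrightarrow> z \<in> smooth_pts (0, 1)"
proof -
  have [measurable]: "S \<in> sets borel" using open_S by simp
  let ?N = "\<lambda>e. S - smooth_pts e"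
  have m: "?N e \<in> sets (lborel \<Otimes>\<^sub>M lborel)" for e
    unfolding lborel_prod by measurable
  have "(\<lambda>x. (x, y)) -` ?N (1, 0) = {t. (0, y) + t *\<^sub>R (1, 0) \<in> ?N (1, 0)}" for y by auto
  then have "emeasure lborel ((\<lambda>x. (x, y)) -` ?N (1, 0)) = 0" for y
    using countable_not_smooth[of "(0, y)" "(1, 0)"] by (simp add: emeasure_lborel_countable)
  then have "emeasure lborel (?N (1, 0)) = 0"
    unfolding lborel_prod[symmetric] by (subst lborel_pair.emeasure_pair_measure_alt2[OF m]) simp
  then show "AE z in lborel. z \<in> S \<longrightarrow> z \<in> smooth_pts (1, 0)"
    by (intro AE_I'[of "?N (1, 0)"]) (auto simp: null_sets_def)
  have "Pair x -` ?N (0, 1) = {t. (x, 0) + t *\<^sub>R (0, 1) \<in> ?N (0, 1)}" for x by auto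
  then have "emeasure lborel (Pair x -` ?N (0, 1)) = 0" for x
    using countable_not_smooth[of "(x, 0)" "(0, 1)"] by (simp add: emeasure_lborel_countable)
  then have "emeasure lborel (?N (0, 1)) = 0"
    unfolding lborel_prod[symmetric] by (subst lborel.emeasure_pair_measure_alt[OF m]) simp
  then show "AE z in lborel. z \<in> S \<longrightarrow> z \<in> smooth_pts (0, 1)"
    by (intro AE_I'[of "?N (0, 1)"]) (auto simp: null_sets_def)
qed

lemma energy_x: "energy p (1, 0) = (\<integral>\<^sup>+y. (\<integral>\<^sup>+x. ennreal (\<bar>pd (1, 0) (x, y)\<bar> powr p) \<partial>lborel) \<partial>lborel)"
  unfolding energy_def lborel_prod[symmetric]
  by (subst lborel_pair.nn_integral_snd[symmetric]) (auto simp: lborel_prod)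

lemma energy_y: "energy p (0, 1) = (\<integral>\<^sup>+x. (\<integral>\<^sup>+y. ennreal (\<bar>pd (0, 1) (x, y)\<bar> powr p) \<partial>lborel) \<partial>lborel)"
  unfolding energy_def lborel_prod[symmetric]
  by (subst lborel.nn_integral_fst[symmetric]) (auto simp: lborel_prod)

lemma partial_x:
  assumes "(x, y) \<in> smooth_pts (1, 0)"
  shows "((\<lambda>t. u (t, y)) has_real_derivative pd (1, 0) (x, y)) (at x)"
proof -
  have "(x, y) \<in> S" using assms by (simp add: smooth_pts_def)
  then have "((\<lambda>t. u (x + t, y)) has_real_derivative pd (1, 0) (x, y)) (at 0)"
    using smooth_pts_derivative[OF assms] by (simp add: pd_def)
  then show ?thesis using DERIV_shift[of "\<lambda>t. u (t, y)" _ 0 x] by (simp add: add.commute)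
qed

lemma partial_y:
  assumes "(x, y) \<in> smooth_pts (0, 1)"
  shows "((\<lambda>t. u (x, t)) has_real_derivative pd (0, 1) (x, y)) (at y)"
proof -
  have "(x, y) \<in> S" using assms by (simp add: smooth_pts_def)
  then have "((\<lambda>t. u (x, y + t)) has_real_derivative pd (0, 1) (x, y)) (at 0)"
    using smooth_pts_derivative[OF assms] by (simp add: pd_def)
  then show ?thesis using DERIV_shift[of "\<lambda>t. u (x, t)" _ 0 y] by (simp add: add.commute)
qed

definition smooth :: "(real \<times> real) set" where "smooth = smooth_pts (1, 0) \<inter> smooth_pts (0, 1)"

lemma AE_smooth: "AE z in lborel. z \<in> S \<longrightarrow> z \<in> smooth"
  using AE_smooth_x AE_smooth_y by eventually_elim (auto simp: smooth_def)

text \<open>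
  A small displacement \<open>(h, k)\<close> is the midpoint of \<open>(2 * h, 0)\<close> and \<open>(0, 2 * k)\<close>, so concavity turns the
  two partial derivatives into a lower estimate in all directions.
\<close>
lemma first_order_below:
  assumes "z \<in> smooth" "\<epsilon> > 0"
  obtains d where "d > 0"
    "\<And>h k. \<bar>h\<bar> < d \<Longrightarrow> \<bar>k\<bar> < d \<Longrightarrow> z + (h, k) \<in> S \<and>
      u (z + (h, k)) \<ge> u z + pd (1, 0) z * h + pd (0, 1) z * k - \<epsilon> * (\<bar>h\<bar> + \<bar>k\<bar>)"
proof -
  obtain x y where z: "z = (x, y)" by (cases z)
  have zS: "z \<in> S" using assms by (simp add: smooth_def smooth_pts_def)
  have "((\<lambda>t. u (x + t, y)) has_real_derivative pd (1, 0) z) (at 0)"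
    using smooth_pts_derivative[of z "(1, 0)"] assms zS by (simp add: smooth_def pd_def z)
  from first_order[of "\<lambda>t. u (t, y)", OF this assms(2)] obtain d1 where d1: "d1 > 0"
    "\<And>t. \<bar>t\<bar> < d1 \<Longrightarrow> \<bar>u (x + t, y) - u (x, y) - pd (1, 0) z * t\<bar> \<le> \<epsilon> * \<bar>t\<bar>" by blast
  have "((\<lambda>t. u (x, y + t)) has_real_derivative pd (0, 1) z) (at 0)"
    using smooth_pts_derivative[of z "(0, 1)"] assms zS by (simp add: smooth_def pd_def z)
  from first_order[of "\<lambda>t. u (x, t)", OF this assms(2)] obtain d2 where d2: "d2 > 0"
    "\<And>t. \<bar>t\<bar> < d2 \<Longrightarrow> \<bar>u (x, y + t) - u (x, y) - pd (0, 1) z * t\<bar> \<le> \<epsilon> * \<bar>t\<bar>" by blast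
  obtain e where e: "e > 0" "ball z e \<subseteq> S" using open_S zS openE by blast
  define d where "d = min (min d1 d2) e / 2"
  have near: "z + (h, k) \<in> S" if "\<bar>h\<bar> + \<bar>k\<bar> < e" for h k
  proof -
    have "dist z (z + (h, k)) \<le> \<bar>h\<bar> + \<bar>k\<bar>"
      using norm_Pair_le[of "- h" "- k"] by (simp add: dist_norm z)
    then have "z + (h, k) \<in> ball z e" using that by simp
    then show ?thesis using e(2) by blast
  qed
  show ?thesis
  proof
    show "d > 0" using d1 d2 e by (simp add: d_def)
    fix h k assume hk: "\<bar>h\<bar> < d" "\<bar>k\<bar> < d"
    have S: "(x + 2 * h, y) \<in> S" "(x, y + 2 * k) \<in> S" "z + (h, k) \<in> S"
      using near[of "2 * h" 0] near[of 0 "2 * k"] near[of h k] hk by (auto simp: z d_def)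
    have "z + (h, k) = (1 - 1/2) *\<^sub>R (x + 2 * h, y) + (1/2) *\<^sub>R (x, y + 2 * k)"
      by (simp add: z algebra_simps)
    then have "u (z + (h, k)) \<ge> (1 - 1/2) * u (x + 2 * h, y) + (1/2) * u (x, y + 2 * k)"
      using concave_onD[OF concave, of "1/2", OF _ _ S(1,2)] by simp
    moreover have "\<bar>u (x + 2 * h, y) - u (x, y) - pd (1, 0) z * (2 * h)\<bar> \<le> \<epsilon> * \<bar>2 * h\<bar>"
      using hk by (intro d1) (auto simp: d_def)
    moreover have "\<bar>u (x, y + 2 * k) - u (x, y) - pd (0, 1) z * (2 * k)\<bar> \<le> \<epsilon> * \<bar>2 * k\<bar>"
      using hk by (intro d2) (auto simp: d_def)
    ultimately show "z + (h, k) \<in> S \<and>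
      u (z + (h, k)) \<ge> u z + pd (1, 0) z * h + pd (0, 1) z * k - \<epsilon> * (\<bar>h\<bar> + \<bar>k\<bar>)"
      using S(3) by (simp add: z abs_mult abs_le_iff algebra_simps)
  qed
qed

text \<open>
  Partial derivatives of a concave function already determine a supporting plane: \<open>z\<close> lies between \<open>\<zeta>\<close> and
  the reflection of a small step towards \<open>\<zeta>\<close>, where \<open>first_order_below\<close> bounds \<open>u\<close> from below, so
  concavity bounds \<open>u \<zeta>\<close> from above.
\<close>
lemma supergradient:
  assumes "z \<in> smooth" and T: "concave_on T u" "S \<subseteq> T" and \<zeta>: "\<zeta> \<in> T"
  shows "u \<zeta> \<le> u z + pd (1, 0) z * (fst \<zeta> - fst z) + pd (0, 1) z * (snd \<zeta> - snd z)"
proof (rule field_le_epsilon)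
  fix \<epsilon> :: real assume "\<epsilon> > 0"
  obtain h k where hk: "\<zeta> = z + (h, k)" by (metis add_diff_cancel_left' diff_add_cancel surj_pair add.commute)
  define M where "M = \<bar>h\<bar> + \<bar>k\<bar> + 1"
  have M: "M > 0" "\<bar>h\<bar> < M" "\<bar>k\<bar> < M" by (auto simp: M_def)
  obtain d where d: "d > 0" "\<And>h k. \<bar>h\<bar> < d \<Longrightarrow> \<bar>k\<bar> < d \<Longrightarrow> z + (h, k) \<in> S \<and>
      u (z + (h, k)) \<ge> u z + pd (1, 0) z * h + pd (0, 1) z * k - \<epsilon> / M * (\<bar>h\<bar> + \<bar>k\<bar>)"
    using first_order_below[OF assms(1), of "\<epsilon> / M"] M \<open>\<epsilon> > 0\<close> by auto
  \<comment> \<open>step length that keeps \<open>(t * h, t * k)\<close> within \<open>d\<close>\<close>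
  define t where "t = d / M"
  have t: "t > 0" using d M by (simp add: t_def)
  have small: "\<bar>t * h\<bar> < d" "\<bar>t * k\<bar> < d"
    using d(1) M by (auto simp: t_def abs_mult field_simps)
  then have b: "z + (- (t * h), - (t * k)) \<in> S"
     "u (z + (- (t * h), - (t * k))) \<ge> u z - t * (pd (1, 0) z * h + pd (0, 1) z * k) - \<epsilon> / M * (t * (\<bar>h\<bar> + \<bar>k\<bar>))"
    using d(2)[of "- (t * h)" "- (t * k)"] t by (auto simp: abs_mult algebra_simps)
  have zz: "z = (1 - t / (1 + t)) *\<^sub>R (z + (- (t * h), - (t * k))) + (t / (1 + t)) *\<^sub>R \<zeta>"
  proof -
    have "(1 - t / (1 + t)) * (a - t * b) + t / (1 + t) * (a + b) = a" for a b
    proof -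
      have "1 - t / (1 + t) = 1 / (1 + t)" using t by (simp add: field_simps)
      then have "(1 - t / (1 + t)) * (a - t * b) + t / (1 + t) * (a + b)
          = ((a - t * b) + t * (a + b)) / (1 + t)"
        by (simp add: add_divide_distrib)
      also have "(a - t * b) + t * (a + b) = a * (1 + t)" by (simp add: algebra_simps)
      finally show ?thesis using t by simp
    qed
    then show ?thesis by (cases z) (simp add: hk)
  qed
  have t1: "1 - t / (1 + t) = 1 / (1 + t)" "0 \<le> t / (1 + t)" "t / (1 + t) \<le> 1"
    using t by (auto simp: field_simps)
  have "u z \<ge> (1 - t / (1 + t)) * u (z + (- (t * h), - (t * k))) + t / (1 + t) * u \<zeta>"
    using concave_onD[OF T(1), of "t / (1 + t)" "z + (- (t * h), - (t * k))" \<zeta>] b(1) T(2) \<zeta> t1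
    by (subst zz) auto
  then have "(1 + t) * u z \<ge> u (z + (- (t * h), - (t * k))) + t * u \<zeta>"
  proof -
    assume "u z \<ge> (1 - t / (1 + t)) * u (z + (- (t * h), - (t * k))) + t / (1 + t) * u \<zeta>"
    then have "u z \<ge> (u (z + (- (t * h), - (t * k))) + t * u \<zeta>) / (1 + t)"
      unfolding t1 by (simp add: add_divide_distrib)
    then show ?thesis using t by (simp add: pos_divide_le_eq mult.commute)
  qed
  with b(2) have "t * u \<zeta> \<le> t * (u z + pd (1, 0) z * h + pd (0, 1) z * k + \<epsilon> / M * (\<bar>h\<bar> + \<bar>k\<bar>))"
    by (simp add: algebra_simps)
  then have "u \<zeta> \<le> u z + pd (1, 0) z * h + pd (0, 1) z * k + \<epsilon> / M * (\<bar>h\<bar> + \<bar>k\<bar>)"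
    using t by simp
  also have "\<epsilon> / M * (\<bar>h\<bar> + \<bar>k\<bar>) \<le> \<epsilon>"
    using M \<open>\<epsilon> > 0\<close> by (simp add: M_def field_simps)
  finally show "u \<zeta> \<le> u z + pd (1, 0) z * (fst \<zeta> - fst z) + pd (0, 1) z * (snd \<zeta> - snd z) + \<epsilon>"
    by (simp add: hk)
qed

text \<open>
  The error is squeezed between \<open>first_order_below\<close> and \<open>supergradient\<close>. This makes the bound
  on gradients in \<^const>\<open>concave_class\<close> available at almost every point.
\<close>
lemma smooth_differentiable:
  assumes z: "z \<in> smooth"
  shows "u differentiable (at z)"
proof -
  have "(u has_derivative (\<lambda>w. pd (1, 0) z * fst w + pd (0, 1) z * snd w)) (at z)"
    unfolding has_derivative_at_alt
  proof (intro conjI allI impI)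
    show "bounded_linear (\<lambda>w. pd (1, 0) z * fst w + pd (0, 1) z * snd w)"
      by (intro bounded_linear_add bounded_linear_mult_const bounded_linear_const_mult bounded_linear_fst bounded_linear_snd)
    fix \<epsilon> :: real assume "0 < \<epsilon>"
    then obtain d where d: "d > 0" "\<And>h k. \<bar>h\<bar> < d \<Longrightarrow> \<bar>k\<bar> < d \<Longrightarrow> z + (h, k) \<in> S \<and>
      u (z + (h, k)) \<ge> u z + pd (1, 0) z * h + pd (0, 1) z * k - \<epsilon> / 2 * (\<bar>h\<bar> + \<bar>k\<bar>)"
      using first_order_below[OF z, of "\<epsilon> / 2"] by auto
    have "norm (u w - u z - (pd (1, 0) z * fst (w - z) + pd (0, 1) z * snd (w - z))) \<le> \<epsilon> * norm (w - z)"
      if w: "norm (w - z) < d" for w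
    proof -
      obtain h k where hk: "w - z = (h, k)" by (cases "w - z")
      then have w': "w = z + (h, k)" by (simp add: algebra_simps flip: hk)
      have n: "\<bar>h\<bar> \<le> norm (w - z)" "\<bar>k\<bar> \<le> norm (w - z)"
        unfolding hk by (auto simp: norm_Pair abs_le_square_iff real_le_rsqrt)
      then have l: "w \<in> S" "u w \<ge> u z + pd (1, 0) z * h + pd (0, 1) z * k - \<epsilon> / 2 * (\<bar>h\<bar> + \<bar>k\<bar>)"
        using d(2)[of h k] w w' by auto
      have "\<epsilon> / 2 * (\<bar>h\<bar> + \<bar>k\<bar>) \<le> \<epsilon> / 2 * (norm (w - z) + norm (w - z))"
        using n \<open>0 < \<epsilon>\<close> by (intro mult_left_mono add_mono) auto
      then have "\<epsilon> / 2 * (\<bar>h\<bar> + \<bar>k\<bar>) \<le> \<epsilon> * norm (w - z)" by simp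
      moreover have "u w \<le> u z + pd (1, 0) z * h + pd (0, 1) z * k"
        using supergradient[OF z concave subset_refl l(1)] by (simp add: w')
      ultimately have "\<bar>u w - u z - (pd (1, 0) z * h + pd (0, 1) z * k)\<bar> \<le> \<epsilon> * norm (w - z)"
        using l(2) by linarith
      then show ?thesis by (simp add: hk)
    qed
    then show "\<exists>d>0. \<forall>w. norm (w - z) < d \<longrightarrow>
        norm (u w - u z - (pd (1, 0) z * fst (w - z) + pd (0, 1) z * snd (w - z))) \<le> \<epsilon> * norm (w - z)"
      using d(1) by blast
  qed
  then show ?thesis by (rule differentiableI)
qed

lemma smooth_deriv:
  assumes "z \<in> smooth"
  shows "deriv_x u z = pd (1, 0) z" "deriv_y u z = pd (0, 1) z"
  using assms partial_x[of "fst z" "snd z"] partial_y[of "fst z" "snd z"]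
  by (auto simp: smooth_def deriv_x_def deriv_y_def intro!: DERIV_imp_deriv)

text \<open>
  The frontier of a convex set is negligible and almost every interior point is smooth, so the possibly
  nonmeasurable integrand agrees almost everywhere with a Borel function.
\<close>
lemma Lp_norm_eq_energy:
  assumes \<Omega>: "interior \<Omega> = S" "convex \<Omega>" and f: "\<And>z. z \<in> smooth \<Longrightarrow> f z = pd e z"
  shows "Lp_norm p \<Omega> f = enn2real (energy p e) powr (1 / p)"
proof -
  have [measurable]: "S \<in> sets borel" using open_S by simp
  let ?g = "\<lambda>z. \<bar>pd e z\<bar> powr p"
  have "AE z in lebesgue. z \<notin> frontier \<Omega>"
    by (rule AE_not_in) (use negligible_convex_frontier[OF \<Omega>(2)] in \<open>simp add: negligible_iff_null_sets\<close>)
  moreover have "AE z in lebesgue. z \<in> S \<longrightarrow> z \<in> smooth"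
    by (rule AE_completion[OF AE_smooth])
  ultimately have ae: "AE z in lebesgue. ?g z = indicator \<Omega> z *\<^sub>R \<bar>f z\<bar> powr p"
  proof eventually_elim
    case (elim z)
    show ?case
    proof (cases "z \<in> S")
      case True
      then have "f z = pd e z" "z \<in> \<Omega>" using elim f interior_subset \<Omega>(1) by blast+
      then show ?thesis by simp
    next
      case False
      then have "z \<notin> \<Omega>" using elim \<Omega>(1) closure_subset by (auto simp: frontier_def)
      then show ?thesis using False by (simp add: pd_def)
    qed
  qed
  have g: "?g \<in> borel_measurable lborel" by measurable
  have gl: "?g \<in> borel_measurable lebesgue" by (rule measurable_completion[OF g])
  have "(LINT z:\<Omega>|lebesgue. \<bar>f z\<bar> powr p) = integral\<^sup>L lebesgue ?g"
    unfolding set_lebesgue_integral_def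
    by (rule integral_cong_AE[OF borel_measurable_AE[OF gl ae] gl]) (use ae in eventually_elim, simp)
  also have "\<dots> = integral\<^sup>L lborel ?g" by (rule integral_completion[OF g])
  also have "\<dots> = enn2real (energy p e)" unfolding energy_def
    by (rule integral_eq_nn_integral[OF g]) simp
  finally show ?thesis by (simp add: Lp_norm_def)
qed

lemma energy_finite:
  assumes b: "bounded S" and B: "\<And>z. z \<in> smooth \<Longrightarrow> \<bar>pd e z\<bar> \<le> B" and p: "1 \<le> p"
  shows "energy p e < \<infinity>"
proof -
  have [measurable]: "S \<in> sets borel" using open_S by simp
  have "energy p e \<le> (\<integral>\<^sup>+z. ennreal (B powr p) * indicator S z \<partial>lborel)"
    unfolding energy_def
  proof (intro nn_integral_mono_AE)
    show "AE z in lborel. ennreal (\<bar>pd e z\<bar> powr p) \<le> ennreal (B powr p) * indicator S z"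
      using AE_smooth
    proof eventually_elim
      case (elim z)
      then show ?case using B[of z] p
        by (cases "z \<in> S") (auto intro!: ennreal_leI powr_mono2 simp: pd_def)
    qed
  qed
  also have "\<dots> = ennreal (B powr p) * emeasure lborel S"
    by (subst nn_integral_cmult_indicator) auto
  also have "\<dots> < \<infinity>" using emeasure_bounded_finite[OF b]
    by (auto simp: ennreal_mult_less_top)
  finally show ?thesis .
qed

end

section \<open>Finiteness of the quotient as an energy inequality\<close>

lemma concave_class_plane:
  assumes "u \<in> concave_class \<Omega>" "convex \<Omega>"
  shows "concave_plane (interior \<Omega>) u"
proof
  have "concave_on \<Omega> u" using assms by (simp add: concave_class_def)
  then show "concave_on (interior \<Omega>) u"
    using convex_on_subset[of \<Omega> "\<lambda>z. - u z" "interior \<Omega>"] interior_subset convex_interior[OF assms(2)]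
    by (auto simp: concave_on_def)
qed simp

definition energy_x :: "real \<Rightarrow> (real \<times> real) set \<Rightarrow> (real \<times> real \<Rightarrow> real) \<Rightarrow> real" where
  "energy_x p \<Omega> u = enn2real (concave_fun.energy (interior \<Omega>) u p (1, 0))"

definition energy_y :: "real \<Rightarrow> (real \<times> real) set \<Rightarrow> (real \<times> real \<Rightarrow> real) \<Rightarrow> real" where
  "energy_y p \<Omega> u = enn2real (concave_fun.energy (interior \<Omega>) u p (0, 1))"

lemma concave_class_energy:
  assumes u: "u \<in> concave_class \<Omega>" and \<Omega>: "convex_compact_domain \<Omega>" and p: "1 < p"
  shows "concave_fun.energy (interior \<Omega>) u p (1, 0) = ennreal (energy_x p \<Omega> u)"
    and "concave_fun.energy (interior \<Omega>) u p (0, 1) = ennreal (energy_y p \<Omega> u)"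
    and "Lp_norm p \<Omega> (deriv_x u) = energy_x p \<Omega> u powr (1 / p)"
    and "Lp_norm p \<Omega> (deriv_y u) = energy_y p \<Omega> u powr (1 / p)"
proof -
  have c: "convex \<Omega>" "compact \<Omega>" using \<Omega> by (auto simp: convex_compact_domain_def)
  interpret concave_plane "interior \<Omega>" u by (rule concave_class_plane[OF u c(1)])
  obtain B where B: "\<And>z. z \<in> interior \<Omega> \<Longrightarrow> u differentiable (at z) \<Longrightarrow> norm (deriv_x u z, deriv_y u z) \<le> B"
    using u by (auto simp: concave_class_def)
  have B': "\<bar>pd (1, 0) z\<bar> \<le> B" "\<bar>pd (0, 1) z\<bar> \<le> B" if z: "z \<in> smooth" for z
  proof -
    have "norm (pd (1, 0) z, pd (0, 1) z) \<le> B"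
      using B[of z] smooth_differentiable[OF z] smooth_deriv[OF z] z
      by (auto simp: smooth_def smooth_pts_def)
    moreover have "\<bar>pd (1, 0) z\<bar> \<le> norm (pd (1, 0) z, pd (0, 1) z)" "\<bar>pd (0, 1) z\<bar> \<le> norm (pd (1, 0) z, pd (0, 1) z)"
      by (auto simp: norm_Pair real_le_rsqrt)
    ultimately show "\<bar>pd (1, 0) z\<bar> \<le> B" "\<bar>pd (0, 1) z\<bar> \<le> B" by linarith+
  qed
  have b: "bounded (interior \<Omega>)" using c(2) bounded_interior compact_imp_bounded by blast
  show "energy p (1, 0) = ennreal (energy_x p \<Omega> u)" "energy p (0, 1) = ennreal (energy_y p \<Omega> u)"
    unfolding energy_x_def energy_y_def
    using energy_finite[OF b B'(1), of p] energy_finite[OF b B'(2), of p] p by auto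
  show "Lp_norm p \<Omega> (deriv_x u) = energy_x p \<Omega> u powr (1 / p)"
    "Lp_norm p \<Omega> (deriv_y u) = energy_y p \<Omega> u powr (1 / p)"
    unfolding energy_x_def energy_y_def
    by (intro Lp_norm_eq_energy refl c smooth_deriv; assumption)+
qed

lemma energy_nonneg: "0 \<le> energy_x p \<Omega> u" "0 \<le> energy_y p \<Omega> u"
  by (auto simp: energy_x_def energy_y_def)

text \<open>
  The case \<open>energy_y p \<Omega> u = 0\<close> is absorbed by the conventions for division: the quotient is infinite
  unless \<open>energy_x p \<Omega> u\<close> is 0 as well, and then \<open>0 / 0 = 0\<close>.
\<close>
lemma K_finite_iff:
  assumes \<Omega>: "convex_compact_domain \<Omega>" and p: "1 < p"
  shows "K p \<Omega> < \<infinity> \<longleftrightarrow>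
    (\<exists>k\<ge>0. \<forall>u\<in>concave_class \<Omega>. (\<exists>z\<in>\<Omega>. u z \<noteq> 0) \<longrightarrow> energy_x p \<Omega> u \<le> k * energy_y p \<Omega> u)"
    (is "?L \<longleftrightarrow> ?R")
proof
  assume ?L
  then obtain k where k: "K p \<Omega> = ennreal k" "k \<ge> 0" by (cases "K p \<Omega>") auto
  have "energy_x p \<Omega> u \<le> k powr p * energy_y p \<Omega> u"
    if u: "u \<in> concave_class \<Omega>" "\<exists>z\<in>\<Omega>. u z \<noteq> 0" for u
  proof -
    let ?X = "energy_x p \<Omega> u powr (1 / p)" and ?Y = "energy_y p \<Omega> u powr (1 / p)"
    have le: "ennreal ?X / ennreal ?Y \<le> ennreal k"
      unfolding k(1)[symmetric] K_def using u
      by (intro SUP_upper2[of u]) (auto simp: concave_class_energy[OF u(1) \<Omega> p])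
    have "?X \<le> k * ?Y"
    proof (cases "?Y = 0")
      case True
      then have "?X = 0" using le by (auto simp: ennreal_divide_zero top_unique split: if_splits)
      then show ?thesis by (simp add: True)
    next
      case False
      then have "ennreal (?X / ?Y) \<le> ennreal k" using le by (simp add: divide_ennreal)
      then have "?X / ?Y \<le> k" using k(2) by simp
      then show ?thesis using False by (simp add: field_simps)
    qed
    then have "?X powr p \<le> (k * ?Y) powr p" using p by (intro powr_mono2) auto
    then show ?thesis using p k(2) energy_nonneg by (simp add: powr_mult powr_powr)
  qed
  then show ?R by (intro exI[of _ "k powr p"]) auto
next
  assume ?R
  then obtain k where k: "k \<ge> 0" "\<And>u. u \<in> concave_class \<Omega> \<Longrightarrow> \<exists>z\<in>\<Omega>. u z \<noteq> 0 \<Longrightarrow>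
    energy_x p \<Omega> u \<le> k * energy_y p \<Omega> u" by blast
  have "K p \<Omega> \<le> ennreal (k powr (1 / p))"
    unfolding K_def
  proof (intro SUP_least, clarify)
    fix u z assume u: "u \<in> concave_class \<Omega>" and z: "z \<in> \<Omega>" "u z \<noteq> 0"
    let ?X = "energy_x p \<Omega> u powr (1 / p)" and ?Y = "energy_y p \<Omega> u powr (1 / p)"
    have "?X \<le> (k * energy_y p \<Omega> u) powr (1 / p)"
      using k(2)[OF u] z p energy_nonneg by (intro powr_mono2) auto
    then have XY: "?X \<le> k powr (1 / p) * ?Y" using k(1) energy_nonneg by (simp add: powr_mult)
    show "ennreal (Lp_norm p \<Omega> (deriv_x u)) / ennreal (Lp_norm p \<Omega> (deriv_y u)) \<le> ennreal (k powr (1 / p))"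
    proof (cases "?Y = 0")
      case True
      then have "?X = 0" using XY by (metis mult_zero_right order_antisym powr_ge_zero)
      then show ?thesis by (simp add: concave_class_energy[OF u \<Omega> p])
    next
      case False
      then have "?Y > 0" by (simp add: less_le)
      then have "?X / ?Y \<le> k powr (1 / p)" using XY by (simp add: field_simps)
      then show ?thesis using \<open>?Y > 0\<close> by (simp add: concave_class_energy[OF u \<Omega> p] divide_ennreal ennreal_leI)
    qed
  qed
  then show ?L using le_less_trans ennreal_less_top infinity_ennreal_def by metis
qed

section \<open>Domains with two angular vertical support lines\<close>

lemma sum_powr_le:
  fixes s t p :: real
  assumes "0 \<le> s" "0 \<le> t" "0 \<le> p"
  shows "(s + t) powr p \<le> 2 powr p * (s powr p + t powr p)"
proof -
  have "(s + t) powr p \<le> (2 * max s t) powr p" using assms by (intro powr_mono2) auto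
  also have "\<dots> = 2 powr p * max s t powr p" using assms by (simp add: powr_mult)
  also have "max s t powr p \<le> s powr p + t powr p" by (auto simp: max_def)
  finally show ?thesis by (simp add: mult_left_mono)
qed

text \<open>
  The function \<open>d\<close> is the horizontal distance to the nearer vertex and \<open>I x\<close> is the energy in the
  \<open>y\<close>-direction on the slice over \<open>x\<close>. The bound \<open>grad\<close> comes from evaluating the supporting plane at the
  two vertices; \<open>slice\<close> and \<open>W_slice\<close> are the Poincare inequality on that slice.
\<close>
lemma energy_x_le_energy_y:
  assumes u: "u \<in> concave_class \<Omega>" and \<Omega>: "convex_compact_domain \<Omega>" and p: "1 < p"
    and M: "M > 0" and A: "(a, \<eta>) \<in> \<Omega>" and B: "(b, \<zeta>) \<in> \<Omega>"
    and coneA: "\<And>x y. (x, y) \<in> \<Omega> \<Longrightarrow> \<bar>y - \<eta>\<bar> \<le> M * (x - a)"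
    and coneB: "\<And>x y. (x, y) \<in> \<Omega> \<Longrightarrow> \<bar>y - \<zeta>\<bar> \<le> M * (b - x)"
  shows "energy_x p \<Omega> u \<le> 2 powr p * ((2 * M) powr p + M powr p) * energy_y p \<Omega> u"
proof -
  have c: "convex \<Omega>" "compact \<Omega>" using \<Omega> by (auto simp: convex_compact_domain_def)
  interpret concave_plane "interior \<Omega>" u by (rule concave_class_plane[OF u c(1)])
  let ?S = "interior \<Omega>"
  have [measurable]: "?S \<in> sets borel" by simp
  have cont: "continuous_on \<Omega> u" and conc: "concave_on \<Omega> u" and zero: "\<And>z. z \<in> frontier \<Omega> \<Longrightarrow> u z = 0"
    using u by (auto simp: concave_class_def)
  have S\<Omega>: "?S \<subseteq> \<Omega>" by (rule interior_subset)
  have inner: "a < x" "x < b" if "(x, y) \<in> ?S" for x y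
  proof -
    have o: "open ((\<lambda>t. (x + t, y)) -` ?S)"
      by (intro open_vimage continuous_intros) simp
    have "0 \<in> (\<lambda>t. (x + t, y)) -` ?S" using that by simp
    from openE[OF o this] obtain \<epsilon> where e: "\<epsilon> > 0" "ball 0 \<epsilon> \<subseteq> (\<lambda>t. (x + t, y)) -` ?S"
      by blast
    have "\<epsilon>/2 \<in> ball 0 \<epsilon>" "- \<epsilon>/2 \<in> ball 0 \<epsilon>" using e(1) by auto
    then have "(x + \<epsilon>/2, y) \<in> \<Omega>" "(x + - \<epsilon>/2, y) \<in> \<Omega>" using e(2) S\<Omega> by blast+
    then have "0 \<le> M * (b - (x + \<epsilon>/2))" "0 \<le> M * (x + - \<epsilon>/2 - a)"
      using coneA coneB abs_ge_zero order_trans by blast+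
    then show "a < x" "x < b" using M e(1) by (auto simp: zero_le_mult_iff)
  qed
  have uA: "u (a, \<eta>) = 0" and uB: "u (b, \<zeta>) = 0"
    using inner[of a \<eta>] inner[of b \<zeta>] A B c(2) by (auto intro!: zero simp: frontier_def closure_closed compact_imp_closed)
  define d where "d x = min (x - a) (b - x)" for x
  define I where "I x = (\<integral>\<^sup>+y. ennreal (\<bar>pd (0, 1) (x, y)\<bar> powr p) \<partial>lborel)" for x
  have grad: "\<bar>pd (1, 0) (x, y)\<bar> \<le> \<bar>u (x, y)\<bar> / d x + M * \<bar>pd (0, 1) (x, y)\<bar>" if z: "(x, y) \<in> smooth" for x y
  proof -
    let ?P = "pd (1, 0) (x, y)" and ?Q = "pd (0, 1) (x, y)"
    have zS: "(x, y) \<in> ?S" using z by (simp add: smooth_def smooth_pts_def)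
    note ab = inner[OF zS]
    have dpos: "d x > 0" using ab by (simp add: d_def)
    have key: "P \<le> \<bar>u (x, y)\<bar> / d x + M * \<bar>?Q\<bar>"
      if "P * h \<le> u (x, y) + ?Q * k" "\<bar>k\<bar> \<le> M * h" "d x \<le> h" for P h k
    proof -
      have "h > 0" using dpos that by simp
      have "?Q * k \<le> \<bar>?Q\<bar> * \<bar>k\<bar>" by (simp add: abs_mult[symmetric])
      also have "\<dots> \<le> \<bar>?Q\<bar> * (M * h)" using that by (intro mult_left_mono) auto
      finally have "P * h \<le> \<bar>u (x, y)\<bar> + \<bar>?Q\<bar> * (M * h)" using that by linarith
      then have "P \<le> \<bar>u (x, y)\<bar> / h + M * \<bar>?Q\<bar>" using \<open>h > 0\<close> by (simp add: field_simps)
      moreover have "\<bar>u (x, y)\<bar> / h \<le> \<bar>u (x, y)\<bar> / d x"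
        using dpos that by (intro divide_left_mono) auto
      ultimately show ?thesis by simp
    qed
    have "?P * (x - a) \<le> u (x, y) + ?Q * (\<eta> - y)"
      using supergradient[OF z conc S\<Omega> A] by (simp add: uA algebra_simps)
    then have "?P \<le> \<bar>u (x, y)\<bar> / d x + M * \<bar>?Q\<bar>"
      by (rule key) (use coneA[of x y] zS S\<Omega> in \<open>auto simp: d_def abs_minus_commute\<close>)
    moreover have "- ?P * (b - x) \<le> u (x, y) + ?Q * (\<zeta> - y)"
      using supergradient[OF z conc S\<Omega> B] by (simp add: uB algebra_simps)
    then have "- ?P \<le> \<bar>u (x, y)\<bar> / d x + M * \<bar>?Q\<bar>"
      by (rule key) (use coneB[of x y] zS S\<Omega> in \<open>auto simp: d_def abs_minus_commute\<close>)
    ultimately show ?thesis by linarith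
  qed
  have slice: "ennreal ((\<bar>u (x, y)\<bar> / d x) powr p) \<le> ennreal ((2 * M) powr (p - 1) / d x) * I x"
    if zS: "(x, y) \<in> ?S" for x y
  proof -
    have dpos: "d x > 0" using inner[OF zS] by (simp add: d_def)
    obtain \<tau> where \<tau>: "\<tau> > 0" "(x, y) + \<tau> *\<^sub>R (0, -1) \<in> frontier \<Omega>"
      "\<And>t. 0 \<le> t \<Longrightarrow> t < \<tau> \<Longrightarrow> (x, y) + t *\<^sub>R (0, -1) \<in> ?S"
      by (rule ray_to_frontier[OF compact_imp_bounded[OF c(2)] zS, of "(0, -1)"])
         (auto simp: zero_prod_def)
    have f\<Omega>: "(x, y - \<tau>) \<in> \<Omega>" and uf: "u (x, y - \<tau>) = 0"
      using \<tau>(2) zero frontier_subset_closed[OF compact_imp_closed[OF c(2)]] by auto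
    have "(x, y) \<in> \<Omega>" using zS S\<Omega> by auto
    then have \<tau>d: "\<tau> \<le> 2 * M * d x"
      using coneA[OF f\<Omega>] coneB[OF f\<Omega>] coneA[of x y] coneB[of x y] by (auto simp: d_def min_def abs_le_iff)
    have S: "(x, t) \<in> ?S" if "y - \<tau> < t" "t \<le> y" for t
      using \<tau>(3)[of "y - t"] that by simp
    have "(x, t) \<in> \<Omega>" if "t \<in> {y - \<tau>..y}" for t
      using S[of t] S\<Omega> f\<Omega> that by (cases "t = y - \<tau>") auto
    then have "continuous_on {y - \<tau>..y} (\<lambda>t. u (x, t))"
      by (intro continuous_on_compose2[OF cont, of _ "Pair x"] continuous_on_Pair continuous_on_const continuous_on_id) auto
    then have "ennreal (\<bar>u (x, y)\<bar> powr p * \<tau> powr (1 - p)) \<le> I x"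
      using segment_energy[of "y - \<tau>" y p "(x, 0)" "(0, 1)"] \<tau>(1) p S uf by (simp add: I_def)
    moreover have "\<bar>u (x, y)\<bar> powr p * (2 * M * d x) powr (1 - p) \<le> \<bar>u (x, y)\<bar> powr p * \<tau> powr (1 - p)"
      using \<tau>d \<tau>(1) p by (intro mult_left_mono powr_mono2') auto
    ultimately have "ennreal (\<bar>u (x, y)\<bar> powr p * (2 * M * d x) powr (1 - p)) \<le> I x"
      using order_trans ennreal_leI by blast
    then have "ennreal ((2 * M) powr (p - 1) / d x) * ennreal (\<bar>u (x, y)\<bar> powr p * (2 * M * d x) powr (1 - p))
        \<le> ennreal ((2 * M) powr (p - 1) / d x) * I x"
      by (rule mult_left_mono) simp
    moreover have "(2 * M) powr (p - 1) / d x * (\<bar>u (x, y)\<bar> powr p * (2 * M * d x) powr (1 - p)) = (\<bar>u (x, y)\<bar> / d x) powr p"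
    proof -
      have "(2 * M) powr (p - 1) * (2 * M) powr (1 - p) = 1" using M by (simp add: powr_add[symmetric])
      moreover have "d x powr (1 - p) / d x = 1 / d x powr p" using dpos by (simp add: powr_diff)
      moreover have "(2 * M * d x) powr (1 - p) = (2 * M) powr (1 - p) * d x powr (1 - p)"
        using M dpos by (intro powr_mult)
      moreover have "(\<bar>u (x, y)\<bar> / d x) powr p = \<bar>u (x, y)\<bar> powr p * (1 / d x powr p)"
        using dpos by (simp add: powr_divide)
      moreover have "P / h * (U * (P' * Q)) = U * R" if "P * P' = 1" "Q / h = R" for P P' Q R U h :: real
      proof -
        have "P / h * (U * (P' * Q)) = (P * P') * (U * (Q / h))" by simp
        with that show ?thesis by simp
      qed
      ultimately show ?thesis by simp
    qed
    ultimately show ?thesis by (simp add: ennreal_mult[symmetric] dpos less_imp_le)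
  qed
  define W where "W z = ennreal ((2 * M) powr (p - 1) / d (fst z)) * I (fst z) * indicator ?S z" for z
  have [measurable]: "I \<in> borel_measurable borel"
    unfolding I_def by measurable
  have [measurable]: "d \<in> borel_measurable borel" unfolding d_def by measurable
  have W_meas [measurable]: "W \<in> borel_measurable borel"
  proof -
    have f: "(fst :: real \<times> real \<Rightarrow> real) \<in> borel_measurable borel"
      by (intro borel_measurable_continuous_onI continuous_on_fst continuous_on_id)
    have g: "(\<lambda>x. ennreal ((2 * M) powr (p - 1) / d x) * I x) \<in> borel_measurable borel" by measurable
    have "(\<lambda>z::real\<times>real. ennreal ((2 * M) powr (p - 1) / d (fst z)) * I (fst z)) \<in> borel_measurable borel"
      by (rule measurable_compose[OF f g])
    moreover have "(indicator ?S :: _ \<Rightarrow> ennreal) \<in> borel_measurable borel"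
      by (rule borel_measurable_indicator) simp
    ultimately show ?thesis
      unfolding W_def[abs_def] by (rule borel_measurable_times_ennreal)
  qed
  have W_slice: "(\<integral>\<^sup>+y. W (x, y) \<partial>lborel) \<le> ennreal ((2 * M) powr p) * I x" for x
  proof (cases "\<exists>y. (x, y) \<in> ?S")
    case False
    then show ?thesis by (simp add: W_def)
  next
    case True
    then have dpos: "d x > 0" using inner by (auto simp: d_def)
    define l where "l = (if x - a \<le> b - x then \<eta> else \<zeta>)"
    have "Pair x -` ?S \<subseteq> {l - M * d x..l + M * d x}"
      using coneA coneB S\<Omega> by (fastforce simp: l_def d_def min_def abs_le_iff)
    then have "emeasure lborel (Pair x -` ?S) \<le> emeasure lborel {l - M * d x..l + M * d x}"
      by (intro emeasure_mono) auto
    also have "\<dots> = ennreal (2 * M * d x)" using M dpos by simp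
    finally have e: "emeasure lborel (Pair x -` ?S) \<le> ennreal (2 * M * d x)" .
    have "(\<integral>\<^sup>+y. W (x, y) \<partial>lborel) = (\<integral>\<^sup>+y. (ennreal ((2 * M) powr (p - 1) / d x) * I x) * indicator (Pair x -` ?S) y \<partial>lborel)"
      by (intro nn_integral_cong) (simp add: W_def indicator_def)
    also have "\<dots> = ennreal ((2 * M) powr (p - 1) / d x) * I x * emeasure lborel (Pair x -` ?S)"
    proof (rule nn_integral_cmult_indicator)
      have "open (Pair x -` ?S)"
        by (rule open_vimage[OF open_interior]) (intro continuous_on_Pair continuous_on_const continuous_on_id)
      then show "Pair x -` ?S \<in> sets lborel" by simp
    qed
    also have "\<dots> \<le> ennreal ((2 * M) powr (p - 1) / d x) * I x * ennreal (2 * M * d x)"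
      by (intro mult_left_mono e) simp
    also have "\<dots> = ennreal ((2 * M) powr (p - 1) / d x * (2 * M * d x)) * I x"
    proof -
      have "ennreal C * J * ennreal c = ennreal (C * c) * J" if "0 \<le> C" "0 \<le> c" for C c J
        using that by (simp add: ennreal_mult ac_simps)
      then show ?thesis using M dpos by simp
    qed
    also have "(2 * M) powr (p - 1) / d x * (2 * M * d x) = (2 * M) powr p"
      using M dpos by (simp add: powr_diff)
    finally show ?thesis .
  qed
  have "(\<integral>\<^sup>+z. W z \<partial>lborel) = (\<integral>\<^sup>+x. (\<integral>\<^sup>+y. W (x, y) \<partial>lborel) \<partial>lborel)"
    unfolding lborel_prod[symmetric] by (subst lborel.nn_integral_fst[symmetric]) (auto simp: lborel_prod)
  also have "\<dots> \<le> (\<integral>\<^sup>+x. ennreal ((2 * M) powr p) * I x \<partial>lborel)"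
    by (intro nn_integral_mono W_slice)
  also have "\<dots> = ennreal ((2 * M) powr p) * energy p (0, 1)"
    by (simp add: nn_integral_cmult energy_y I_def)
  finally have W_le: "(\<integral>\<^sup>+z. W z \<partial>lborel) \<le> ennreal ((2 * M) powr p) * energy p (0, 1)" .
  have "energy p (1, 0) \<le> (\<integral>\<^sup>+z. ennreal (2 powr p) * (W z + ennreal (M powr p) * ennreal (\<bar>pd (0, 1) z\<bar> powr p)) \<partial>lborel)"
    unfolding energy_def
  proof (intro nn_integral_mono_AE)
    show "AE z in lborel. ennreal (\<bar>pd (1, 0) z\<bar> powr p) \<le> ennreal (2 powr p) * (W z + ennreal (M powr p) * ennreal (\<bar>pd (0, 1) z\<bar> powr p))"
      using AE_smooth
    proof eventually_elim
      case (elim z)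
      obtain x y where z: "z = (x, y)" by (cases z)
      show ?case
      proof (cases "z \<in> ?S")
        case True
        then have dpos: "d x > 0" using inner z by (auto simp: d_def)
        have "\<bar>pd (1, 0) z\<bar> powr p \<le> (\<bar>u z\<bar> / d x + M * \<bar>pd (0, 1) z\<bar>) powr p"
          using elim True grad z p by (intro powr_mono2) auto
        also have "\<dots> \<le> 2 powr p * ((\<bar>u z\<bar> / d x) powr p + (M * \<bar>pd (0, 1) z\<bar>) powr p)"
          using dpos M p by (intro sum_powr_le) auto
        finally have "ennreal (\<bar>pd (1, 0) z\<bar> powr p) \<le> ennreal (2 powr p * ((\<bar>u z\<bar> / d x) powr p + (M * \<bar>pd (0, 1) z\<bar>) powr p))"
          by (rule ennreal_leI)
        also have "\<dots> = ennreal (2 powr p) * (ennreal ((\<bar>u z\<bar> / d x) powr p) + ennreal (M powr p) * ennreal (\<bar>pd (0, 1) z\<bar> powr p))"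
          using M by (simp add: ennreal_mult powr_mult)
        also have "\<dots> \<le> ennreal (2 powr p) * (W z + ennreal (M powr p) * ennreal (\<bar>pd (0, 1) z\<bar> powr p))"
          using slice[of x y] True by (intro mult_left_mono add_mono) (auto simp: W_def z)
        finally show ?thesis .
      qed (simp add: pd_def)
    qed
  qed
  also have "\<dots> = ennreal (2 powr p) * ((\<integral>\<^sup>+z. W z \<partial>lborel) + ennreal (M powr p) * energy p (0, 1))"
    unfolding energy_def by (simp add: nn_integral_cmult nn_integral_add)
  also have "\<dots> \<le> ennreal (2 powr p) * (ennreal ((2 * M) powr p) * energy p (0, 1) + ennreal (M powr p) * energy p (0, 1))"
    by (intro mult_left_mono add_right_mono W_le) simp
  finally have "energy p (1, 0) \<le> ennreal (2 powr p) * (ennreal ((2 * M) powr p) * energy p (0, 1) + ennreal (M powr p) * energy p (0, 1))" .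
  then have "ennreal (energy_x p \<Omega> u) \<le> ennreal (2 powr p * ((2 * M) powr p + M powr p) * energy_y p \<Omega> u)"
    unfolding concave_class_energy[OF u \<Omega> p] using energy_nonneg(2)[of p \<Omega> u]
    by (simp add: ennreal_mult[symmetric] ennreal_plus[symmetric] algebra_simps del: ennreal_plus)
  then show ?thesis using energy_nonneg(2)[of p \<Omega> u] by (subst (asm) ennreal_le_iff) auto
qed

section \<open>Envelopes of affine functions\<close>

text \<open>
  Infimum of affine functions with gradients in \<open>G\<close>, each lowered as far as nonnegativity on \<open>\<Omega>\<close>
  permits.
\<close>
definition envelope :: "'a::euclidean_space set \<Rightarrow> 'a set \<Rightarrow> 'a \<Rightarrow> real" where
  "envelope G \<Omega> z = (INF g\<in>G. g \<bullet> z - (INF \<zeta>\<in>\<Omega>. g \<bullet> \<zeta>))"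

lemma lipschitz_derivative_bound:
  fixes f :: "real \<Rightarrow> real"
  assumes f: "(f has_real_derivative D) (at a)" and lip: "\<And>t. \<bar>f t - f a\<bar> \<le> C * \<bar>t - a\<bar>"
  shows "\<bar>D\<bar> \<le> C"
proof -
  have "((\<lambda>h. \<bar>(f (a + h) - f a) / h\<bar>) \<longlongrightarrow> \<bar>D\<bar>) (at 0)"
    using f unfolding DERIV_def by (rule tendsto_rabs)
  then show ?thesis
  proof (rule tendsto_upperbound)
    show "\<forall>\<^sub>F h in at 0. \<bar>(f (a + h) - f a) / h\<bar> \<le> C"
      unfolding eventually_at_filter
      using lip[of "a + _"] by (intro always_eventually) (auto simp: abs_divide divide_le_eq)
  qed simp
qed

lemma differentiable_imp_partials:
  fixes u :: "real \<times> real \<Rightarrow> real"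
  assumes "u differentiable (at z)"
  shows "((\<lambda>t. u (t, snd z)) has_real_derivative deriv_x u z) (at (fst z))"
    and "((\<lambda>t. u (fst z, t)) has_real_derivative deriv_y u z) (at (snd z))"
proof -
  have "(\<lambda>t. (t, snd z)) differentiable (at (fst z))" "(\<lambda>t. (fst z, t)) differentiable (at (snd z))"
    unfolding differentiable_def by (auto intro!: exI derivative_intros)
  then have "(u \<circ> (\<lambda>t. (t, snd z))) differentiable (at (fst z))" "(u \<circ> (\<lambda>t. (fst z, t))) differentiable (at (snd z))"
    using assms by (intro differentiable_chain_at; simp)+
  then show "((\<lambda>t. u (t, snd z)) has_real_derivative deriv_x u z) (at (fst z))"
    "((\<lambda>t. u (fst z, t)) has_real_derivative deriv_y u z) (at (snd z))"
    unfolding deriv_x_def deriv_y_def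
    by (auto simp: comp_def DERIV_deriv_iff_real_differentiable)
qed

locale bounded_gradients =
  fixes G \<Omega> :: "'a::euclidean_space set" and C :: real
  assumes compact: "compact \<Omega>" and nonempty: "\<Omega> \<noteq> {}" "G \<noteq> {}"
    and G_bound: "\<And>g. g \<in> G \<Longrightarrow> norm g \<le> C"
begin

lemma INF_inner_le: "\<zeta> \<in> \<Omega> \<Longrightarrow> (INF \<zeta>\<in>\<Omega>. g \<bullet> \<zeta>) \<le> g \<bullet> \<zeta>"
proof (rule cINF_lower)
  have "compact ((\<lambda>\<zeta>. g \<bullet> \<zeta>) ` \<Omega>)"
    by (intro compact_continuous_image compact continuous_intros)
  then show "bdd_below ((\<lambda>\<zeta>. g \<bullet> \<zeta>) ` \<Omega>)" by (intro bounded_imp_bdd_below compact_imp_bounded)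
qed

lemma envelope_le:
  assumes "g \<in> G"
  shows "envelope G \<Omega> z \<le> g \<bullet> z - (INF \<zeta>\<in>\<Omega>. g \<bullet> \<zeta>)"
  unfolding envelope_def
proof (rule cINF_lower[OF _ assms])
  obtain \<zeta> where \<zeta>: "\<zeta> \<in> \<Omega>" using nonempty by auto
  have "- (C * norm (z - \<zeta>)) \<le> g \<bullet> z - (INF \<zeta>\<in>\<Omega>. g \<bullet> \<zeta>)" if "g \<in> G" for g
  proof -
    have "\<bar>g \<bullet> (z - \<zeta>)\<bar> \<le> norm g * norm (z - \<zeta>)" by (rule Cauchy_Schwarz_ineq2)
    also have "\<dots> \<le> C * norm (z - \<zeta>)" using G_bound[OF that] by (intro mult_right_mono) auto
    finally show ?thesis using INF_inner_le[OF \<zeta>, of g] by (simp add: inner_diff_right)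
  qed
  then show "bdd_below ((\<lambda>g. g \<bullet> z - (INF \<zeta>\<in>\<Omega>. g \<bullet> \<zeta>)) ` G)" by (rule bdd_belowI2)
qed

lemma envelope_ge:
  assumes "\<And>g. g \<in> G \<Longrightarrow> \<exists>\<zeta>\<in>\<Omega>. c \<le> g \<bullet> (z - \<zeta>)"
  shows "c \<le> envelope G \<Omega> z"
  unfolding envelope_def
proof (rule cINF_greatest[OF nonempty(2)])
  fix g assume "g \<in> G"
  then obtain \<zeta> where "\<zeta> \<in> \<Omega>" "c \<le> g \<bullet> (z - \<zeta>)" using assms by blast
  then show "c \<le> g \<bullet> z - (INF \<zeta>\<in>\<Omega>. g \<bullet> \<zeta>)"
    using INF_inner_le[of \<zeta> g] by (simp add: inner_diff_right)
qed

lemma envelope_nonneg: "z \<in> \<Omega> \<Longrightarrow> 0 \<le> envelope G \<Omega> z"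
  by (rule envelope_ge) (auto intro: bexI[of _ z])

lemma envelope_eq_0:
  assumes z: "z \<in> \<Omega>" and g: "g \<in> G" and min: "\<And>\<zeta>. \<zeta> \<in> \<Omega> \<Longrightarrow> g \<bullet> z \<le> g \<bullet> \<zeta>"
  shows "envelope G \<Omega> z = 0"
proof (rule antisym[OF _ envelope_nonneg[OF z]])
  have "g \<bullet> z \<le> (INF \<zeta>\<in>\<Omega>. g \<bullet> \<zeta>)" using min by (intro cINF_greatest nonempty)
  then show "envelope G \<Omega> z \<le> 0" using envelope_le[OF g, of z] by simp
qed

text \<open>
  One-sided slope bounds pass from the members to the infimum. This gives both the Lipschitz constant and,
  for suitable directions \<open>d\<close>, the constraint that links \<open>u\<^sub>x\<close> and \<open>u\<^sub>y\<close>.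
\<close>
lemma envelope_step:
  assumes "\<And>g. g \<in> G \<Longrightarrow> - c \<le> g \<bullet> d"
  shows "envelope G \<Omega> z - c \<le> envelope G \<Omega> (z + d)"
  unfolding envelope_def[of _ _ "z + d"]
proof (rule cINF_greatest[OF nonempty(2)])
  fix g assume "g \<in> G"
  then show "envelope G \<Omega> z - c \<le> g \<bullet> (z + d) - (INF \<zeta>\<in>\<Omega>. g \<bullet> \<zeta>)"
    using envelope_le[of g z] assms[of g] by (simp add: inner_add_right)
qed

lemma envelope_lipschitz: "\<bar>envelope G \<Omega> z - envelope G \<Omega> w\<bar> \<le> C * norm (z - w)"
proof -
  have "envelope G \<Omega> w - C * norm (z - w) \<le> envelope G \<Omega> (w + (z - w))" for z w
  proof (rule envelope_step)
    fix g assume g: "g \<in> G"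
    have "\<bar>g \<bullet> (z - w)\<bar> \<le> norm g * norm (z - w)" by (rule Cauchy_Schwarz_ineq2)
    also have "\<dots> \<le> C * norm (z - w)" using G_bound[OF g] by (intro mult_right_mono) auto
    finally show "- (C * norm (z - w)) \<le> g \<bullet> (z - w)" by linarith
  qed
  from this[of w z] this[of z w] show ?thesis by (simp add: norm_minus_commute abs_le_iff)
qed

lemma envelope_concave: "convex T \<Longrightarrow> concave_on T (envelope G \<Omega>)"
  unfolding concave_on_iff
proof (intro conjI ballI allI impI)
  fix x y and a b :: real assume ab: "0 \<le> a" "0 \<le> b" "a + b = 1"
  show "envelope G \<Omega> (a *\<^sub>R x + b *\<^sub>R y) \<ge> a * envelope G \<Omega> x + b * envelope G \<Omega> y"
    unfolding envelope_def[of _ _ "a *\<^sub>R x + b *\<^sub>R y"]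
  proof (rule cINF_greatest[OF nonempty(2)])
    fix g assume g: "g \<in> G"
    let ?m = "INF \<zeta>\<in>\<Omega>. g \<bullet> \<zeta>"
    have "a * envelope G \<Omega> x + b * envelope G \<Omega> y \<le> a * (g \<bullet> x - ?m) + b * (g \<bullet> y - ?m)"
      using ab envelope_le[OF g] by (intro add_mono mult_left_mono) auto
    also have "\<dots> = g \<bullet> (a *\<^sub>R x + b *\<^sub>R y) - (a + b) * ?m"
      by (simp add: inner_add_right algebra_simps)
    finally show "a * envelope G \<Omega> x + b * envelope G \<Omega> y \<le> g \<bullet> (a *\<^sub>R x + b *\<^sub>R y) - ?m"
      using ab by simp
  qed
qed

end

text \<open>
  The envelope vanishes on the frontier as soon as every frontier point has an inward normal whose
  direction is represented in \<open>G\<close>.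
\<close>
lemma envelope_in_concave_class:
  fixes \<Omega> :: "(real \<times> real) set"
  assumes "bounded_gradients G \<Omega> C" and "convex \<Omega>"
    and zero: "\<And>z. z \<in> frontier \<Omega> \<Longrightarrow> \<exists>g\<in>G. \<forall>\<zeta>\<in>\<Omega>. g \<bullet> z \<le> g \<bullet> \<zeta>"
  shows "envelope G \<Omega> \<in> concave_class \<Omega>"
proof -
  interpret bounded_gradients G \<Omega> C by fact
  let ?u = "envelope G \<Omega>"
  have "C-lipschitz_on \<Omega> ?u"
  proof (rule lipschitz_onI)
    show "dist (?u x) (?u y) \<le> C * dist x y" for x y
      using envelope_lipschitz[of x y] by (simp add: dist_norm)
    show "0 \<le> C" using G_bound nonempty(2) norm_ge_zero order_trans by blast
  qed
  then have "continuous_on \<Omega> ?u" by (rule lipschitz_on_continuous_on)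
  moreover have "?u z = 0" if "z \<in> frontier \<Omega>" for z
    using zero[OF that] envelope_eq_0 that frontier_subset_closed[OF compact_imp_closed[OF compact]] by blast
  moreover have "norm (deriv_x ?u z, deriv_y ?u z) \<le> 2 * C" if "?u differentiable (at z)" for z
  proof -
    have "\<bar>deriv_x ?u z\<bar> \<le> C"
    proof (rule lipschitz_derivative_bound[OF differentiable_imp_partials(1)[OF that]])
      show "\<bar>?u (t, snd z) - ?u (fst z, snd z)\<bar> \<le> C * \<bar>t - fst z\<bar>" for t
        using envelope_lipschitz[of "(t, snd z)" "(fst z, snd z)"] by (simp add: norm_Pair del: prod.collapse)
    qed
    moreover have "\<bar>deriv_y ?u z\<bar> \<le> C"
    proof (rule lipschitz_derivative_bound[OF differentiable_imp_partials(2)[OF that]])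
      show "\<bar>?u (fst z, t) - ?u (fst z, snd z)\<bar> \<le> C * \<bar>t - snd z\<bar>" for t
        using envelope_lipschitz[of "(fst z, t)" "(fst z, snd z)"] by (simp add: norm_Pair del: prod.collapse)
    qed
    ultimately show ?thesis using norm_Pair_le[of "deriv_x ?u z" "deriv_y ?u z"] by simp
  qed
  ultimately show ?thesis
    using envelope_concave[OF assms(2)]
    unfolding concave_class_def by (intro CollectI conjI ballI exI[of _ "2 * C"] impI)
qed

context concave_plane
begin

text \<open>
  A growth condition in the direction \<open>d\<close> is compared with the supporting plane at \<open>z\<close>.
\<close>
lemma smooth_direction:
  assumes z: "z \<in> smooth" and lower: "\<And>t. 0 \<le> t \<Longrightarrow> u z - t * c \<le> u (z + t *\<^sub>R d)"
  shows "- c \<le> pd (1, 0) z * fst d + pd (0, 1) z * snd d"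
proof -
  have "0 \<in> line d z" using z by (simp add: line_def smooth_def smooth_pts_def)
  then obtain \<epsilon> where e: "\<epsilon> > 0" "ball 0 \<epsilon> \<subseteq> line d z" using open_line openE by blast
  then have "\<epsilon> / 2 \<in> ball 0 \<epsilon>" by simp
  then have "z + (\<epsilon> / 2) *\<^sub>R d \<in> S" using e(2) unfolding line_def by blast
  from supergradient[OF z concave subset_refl this] lower[of "\<epsilon> / 2"] e(1)
  have "\<epsilon> / 2 * - c \<le> \<epsilon> / 2 * (pd (1, 0) z * fst d + pd (0, 1) z * snd d)"
    by (simp add: algebra_simps)
  then show ?thesis using e(1) by (subst (asm) mult_le_cancel_left_pos) auto
qed

end

section \<open>Boundary layers along a steep arc\<close>

text \<open>
  The vertical support line is at abscissa \<open>a\<close>, and \<open>\<sigma>\<close> says on which side of it \<open>\<Omega>\<close> lies. The chord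
  \<open>AB\<close> is nearly vertical and close to the line, compared with its height. The interior point \<open>W\<close> and the
  bound \<open>D\<close> on differences of heights fix the scale on which \<open>h\<close> has to be small.
\<close>
locale steep_boundary =
  fixes \<Omega> :: "(real \<times> real) set" and \<sigma> a h D :: real and A B W :: "real \<times> real"
  assumes domain: "convex_compact_domain \<Omega>"
    and \<sigma>: "\<sigma> = 1 \<or> \<sigma> = -1"
    and side: "\<And>z. z \<in> \<Omega> \<Longrightarrow> 0 \<le> \<sigma> * (fst z - a)"
    and h: "0 < h" "h \<le> 1 / 16"
    and A: "A \<in> \<Omega>" "\<sigma> * (fst A - a) \<le> h * (snd B - snd A)"
    and B: "B \<in> \<Omega>" "\<sigma> * (fst B - a) \<le> h * (snd B - snd A)"
    and AB: "snd A < snd B"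
    and W: "W \<in> interior \<Omega>"
    and D: "0 < D" "\<And>z. z \<in> \<Omega> \<Longrightarrow> \<bar>snd z - snd W\<bar> \<le> D"
    and hW: "h * (16 * D) \<le> \<sigma> * (fst W - a)"
begin

text \<open>
  \<open>X\<close> is the distance from the support line, \<open>r\<close> the height of the chord. A normal counts as nearly
  horizontal if its slope is at most \<open>s\<close>; the factor 8 leaves room in \<open>second_kind_lower\<close>. The three terms
  of \<open>c\<close> are the lower bounds obtained there for the three kinds of remaining normals. The set \<open>G N\<close> holds
  one positive multiple of each inward normal direction: the nearly horizontal ones are scaled to the
  horizontal component \<open>N\<close>, the others are normalised.
\<close>
definition X :: "real \<times> real \<Rightarrow> real" where "X z = \<sigma> * (fst z - a)"
definition r where "r = snd B - snd A"
definition w where "w = X W"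
definition s where "s = 8 * h"
definition c where "c = min (r * h / 2) (min (r / 16) (r * w / (16 * D)))"
definition G :: "real \<Rightarrow> (real \<times> real) set" where
  "G N = {g. fst g = \<sigma> * N \<and> \<bar>snd g\<bar> \<le> s * N} \<union>
     {g. \<bar>fst g\<bar> + \<bar>snd g\<bar> = 1 \<and> \<not> (0 < \<sigma> * fst g \<and> \<bar>snd g\<bar> \<le> s * (\<sigma> * fst g))}"

lemma \<sigma>2: "\<sigma> * \<sigma> = 1" "\<bar>\<sigma>\<bar> = 1" using \<sigma> by auto

lemma conv: "convex \<Omega>" "compact \<Omega>" "\<Omega> \<noteq> {}" "closed \<Omega>"
  using domain by (auto simp: convex_compact_domain_def compact_imp_closed)

lemma pos: "0 < r" "0 < w" "0 < s" "s \<le> 1/2" "0 < c"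
proof -
  show "0 < r" "0 < s" "s \<le> 1/2" using AB h by (auto simp: r_def s_def)
  have "0 < h * (16 * D)" using h D by simp
  then show "0 < w" unfolding w_def X_def using hW by linarith
  with \<open>0 < r\<close> show "0 < c" using h D by (simp add: c_def)
qed

lemma hr_le: "h * r \<le> r / 16" "h * r \<le> r * w / (16 * D)"
proof -
  show "h * r \<le> r / 16" using mult_right_mono[OF h(2), of r] pos by simp
  have "h * (16 * D) * r \<le> w * r" using hW pos by (intro mult_right_mono) (auto simp: w_def X_def)
  then show "h * r \<le> r * w / (16 * D)" using D by (simp add: field_simps)
qed

lemma XAB: "X A \<le> h * r" "X B \<le> h * r" and X_nonneg: "z \<in> \<Omega> \<Longrightarrow> 0 \<le> X z"
  using A B side by (auto simp: X_def r_def)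

lemma inner_eq: "g \<bullet> (z - \<zeta>) = \<sigma> * fst g * (X z - X \<zeta>) + snd g * (snd z - snd \<zeta>)"
proof -
  have "\<sigma> * fst g * (X z - X \<zeta>) = (\<sigma> * \<sigma>) * (fst g * (fst z - fst \<zeta>))" by (simp add: X_def algebra_simps)
  then have "\<sigma> * fst g * (X z - X \<zeta>) = fst g * (fst z - fst \<zeta>)" by (simp only: \<sigma>2 mult_1)
  then show ?thesis by (simp only: inner_prod_def fst_diff snd_diff inner_real_def)
qed

lemma X_convex: "X ((1 - t) *\<^sub>R x + t *\<^sub>R y) = (1 - t) * X x + t * X y"
  by (simp add: X_def algebra_simps)

lemma bounded_gradients_G:
  assumes N: "1 \<le> N"
  shows "bounded_gradients (G N) \<Omega> (2 * N)"
proof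
  show "compact \<Omega>" "\<Omega> \<noteq> {}" by (rule conv)+
  have "(\<sigma> * N, 0) \<in> G N" using pos N by (simp add: G_def)
  then show "G N \<noteq> {}" by blast
  fix g assume "g \<in> G N"
  then have "\<bar>fst g\<bar> + \<bar>snd g\<bar> \<le> 2 * N"
  proof (unfold G_def, elim UnE CollectE conjE)
    assume g: "fst g = \<sigma> * N" "\<bar>snd g\<bar> \<le> s * N"
    have "s * N \<le> 1/2 * N" using pos N by (intro mult_right_mono) auto
    moreover have "\<bar>fst g\<bar> = N" using g N by (simp add: abs_mult \<sigma>2)
    ultimately show ?thesis using g N by linarith
  qed (use N in auto)
  then show "norm g \<le> 2 * N"
    using norm_Pair_le[of "fst g" "snd g"] by simp
qed

lemma envelope_class:
  assumes N: "1 \<le> N"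
  shows "envelope (G N) \<Omega> \<in> concave_class \<Omega>"
proof (rule envelope_in_concave_class[OF bounded_gradients_G[OF N] conv(1)])
  fix z assume z: "z \<in> frontier \<Omega>"
  then have z\<Omega>: "z \<in> \<Omega>" using frontier_subset_closed[OF conv(4)] by blast
  have nri: "z \<notin> rel_interior \<Omega>"
    using z domain by (auto simp: frontier_def convex_compact_domain_def interior_rel_interior_gen split: if_splits)
  obtain v where v: "v \<noteq> 0" "\<And>\<zeta>. \<zeta> \<in> \<Omega> \<Longrightarrow> v \<bullet> z \<le> v \<bullet> \<zeta>"
    using supporting_hyperplane_rel_boundary[OF conv(1) z\<Omega> nri] by metis
  \<comment> \<open>the factor that takes \<open>v\<close> into \<open>G N\<close>\<close>
  define k where "k = (if 0 < \<sigma> * fst v \<and> \<bar>snd v\<bar> \<le> s * (\<sigma> * fst v)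
    then N / (\<sigma> * fst v) else 1 / (\<bar>fst v\<bar> + \<bar>snd v\<bar>))"
  have v0: "\<bar>fst v\<bar> + \<bar>snd v\<bar> > 0" 
  proof -
    have "fst v \<noteq> 0 \<or> snd v \<noteq> 0" using v(1) by (simp add: prod_eq_iff)
    then show ?thesis by linarith
  qed
  have k: "k > 0" using v0 N by (auto simp: k_def)
  have "k *\<^sub>R v \<in> G N"
  proof (cases "0 < \<sigma> * fst v \<and> \<bar>snd v\<bar> \<le> s * (\<sigma> * fst v)")
    case True
    then have kd: "k = N / (\<sigma> * fst v)" by (simp add: k_def)
    have "k * fst v = N * \<sigma>" using True \<sigma> by (auto simp: kd field_simps)
    moreover have "\<bar>k * snd v\<bar> \<le> s * N"
    proof -
      have "\<bar>k * snd v\<bar> \<le> k * (s * (\<sigma> * fst v))" using True k by (simp add: abs_mult)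
      also have "\<dots> = s * N"
      proof -
        have "\<sigma> * fst v \<noteq> 0" using True by linarith
        then show ?thesis by (simp add: kd)
      qed
      finally show ?thesis .
    qed
    ultimately show ?thesis by (simp add: G_def mult.commute)
  next
    case False
    then have kd: "k = 1 / (\<bar>fst v\<bar> + \<bar>snd v\<bar>)" unfolding k_def by (rule if_not_P)
    have "\<bar>k * fst v\<bar> + \<bar>k * snd v\<bar> = k * (\<bar>fst v\<bar> + \<bar>snd v\<bar>)"
      using k by (simp add: abs_mult algebra_simps)
    also have "\<dots> = 1" using v0 by (simp add: kd)
    finally have 1: "\<bar>k * fst v\<bar> + \<bar>k * snd v\<bar> = 1" .
    have "\<not> (0 < \<sigma> * (k * fst v) \<and> \<bar>k * snd v\<bar> \<le> s * (\<sigma> * (k * fst v)))"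
    proof -
      have "0 < \<sigma> * (k * fst v) \<longleftrightarrow> 0 < \<sigma> * fst v"
        unfolding mult.left_commute[of \<sigma> k] zero_less_mult_iff[of k] using k by simp
      moreover have "\<bar>k * snd v\<bar> \<le> s * (\<sigma> * (k * fst v)) \<longleftrightarrow> \<bar>snd v\<bar> \<le> s * (\<sigma> * fst v)"
        unfolding mult.left_commute[of \<sigma> k] mult.left_commute[of s k] using k by (simp add: abs_mult)
      ultimately show ?thesis using False by blast
    qed
    with 1 show ?thesis by (simp add: G_def)
  qed
  moreover have "(k *\<^sub>R v) \<bullet> z \<le> (k *\<^sub>R v) \<bullet> \<zeta>" if "\<zeta> \<in> \<Omega>" for \<zeta>
    using v(2)[OF that] k by simp
  ultimately show "\<exists>g\<in>G N. \<forall>\<zeta>\<in>\<Omega>. g \<bullet> z \<le> g \<bullet> \<zeta>" by blast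
qed

text \<open>
  If the horizontal component of \<open>g\<close> is \<open>\<sigma> * N\<close>, then it compensates the vertical one, uniformly in \<open>N\<close>; the
  other gradients have components bounded by 1.
\<close>
lemma G_direction:
  assumes N: "1 \<le> N" and g: "g \<in> G N" and d: "fst d = \<sigma> * s" "\<bar>snd d\<bar> = 1"
  shows "- (1 + s) \<le> g \<bullet> d"
proof -
  have gd: "g \<bullet> d = s * (\<sigma> * fst g) + snd g * snd d"
    using d by (cases g; cases d) (simp add: algebra_simps)
  have abs: "\<bar>snd g * snd d\<bar> = \<bar>snd g\<bar>" using d by (simp add: abs_mult)
  from g show ?thesis
  proof (unfold G_def, elim UnE CollectE conjE)
    assume g: "fst g = \<sigma> * N" "\<bar>snd g\<bar> \<le> s * N"
    then have "s * (\<sigma> * fst g) = s * N" using \<sigma> by auto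
    then show ?thesis using g abs pos gd by linarith
  next
    assume g: "\<bar>fst g\<bar> + \<bar>snd g\<bar> = 1"
    have "\<bar>s * (\<sigma> * fst g)\<bar> \<le> s" using pos g by (simp add: abs_mult \<sigma>2 mult_left_le)
    then show ?thesis using g abs gd by linarith
  qed
qed

text \<open>
  This combines \<open>G_direction\<close> for the two directions \<open>(\<sigma> * s, 1)\<close> and \<open>(\<sigma> * s, - 1)\<close>, because half-plane
  conditions on the gradients of affine functions survive the passage to their infimum.
\<close>
lemma gradient_bound:
  assumes N: "1 \<le> N" and z: "z \<in> concave_plane.smooth (interior \<Omega>) (envelope (G N) \<Omega>)"
  defines "pd \<equiv> concave_fun.pd (interior \<Omega>) (envelope (G N) \<Omega>)"
  shows "\<bar>pd (0, 1) z\<bar> \<le> s * \<bar>pd (1, 0) z\<bar> + (1 + s)"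
proof -
  interpret E: bounded_gradients "G N" \<Omega> "2 * N" by (rule bounded_gradients_G[OF N])
  interpret U: concave_plane "interior \<Omega>" "envelope (G N) \<Omega>"
    by (rule concave_class_plane[OF envelope_class[OF N] conv(1)])
  have "- (1 + s) \<le> U.pd (1, 0) z * fst (\<sigma> * s, \<tau>) + U.pd (0, 1) z * snd (\<sigma> * s, \<tau>)" if "\<bar>\<tau>\<bar> = 1" for \<tau>
  proof (rule U.smooth_direction[OF z])
    fix t :: real assume t: "0 \<le> t"
    show "envelope (G N) \<Omega> z - t * (1 + s) \<le> envelope (G N) \<Omega> (z + t *\<^sub>R (\<sigma> * s, \<tau>))"
    proof (rule E.envelope_step)
      fix g assume "g \<in> G N"
      then have "t * - (1 + s) \<le> t * (g \<bullet> (\<sigma> * s, \<tau>))"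
        using that t by (intro mult_left_mono G_direction[OF N]) auto
      then show "- (t * (1 + s)) \<le> g \<bullet> (t *\<^sub>R (\<sigma> * s, \<tau>))" by (simp only: inner_scaleR_right mult_minus_right)
    qed
  qed
  from this[of 1] this[of "-1"] have "\<bar>U.pd (0, 1) z\<bar> \<le> U.pd (1, 0) z * (\<sigma> * s) + (1 + s)"
    by (simp add: abs_le_iff)
  moreover have "U.pd (1, 0) z * (\<sigma> * s) \<le> s * \<bar>U.pd (1, 0) z\<bar>"
    using pos abs_ge_self[of "U.pd (1, 0) z * (\<sigma> * s)"] by (simp add: abs_mult \<sigma>2 mult.commute)
  ultimately show ?thesis unfolding pd_def by linarith
qed

lemma energy_y_bound:
  assumes N: "1 \<le> N" and p: "1 < p"
  shows "energy_y p \<Omega> (envelope (G N) \<Omega>) \<le>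
    2 powr p * (s powr p * energy_x p \<Omega> (envelope (G N) \<Omega>) + (1 + s) powr p * measure lborel (interior \<Omega>))"
proof -
  let ?u = "envelope (G N) \<Omega>"
  note cl = envelope_class[OF N]
  interpret U: concave_plane "interior \<Omega>" ?u
    by (rule concave_class_plane[OF cl conv(1)])
  have fin: "emeasure lborel (interior \<Omega>) = ennreal (measure lborel (interior \<Omega>))"
    using emeasure_bounded_finite[OF bounded_interior[OF compact_imp_bounded[OF conv(2)]]]
    by (intro emeasure_eq_ennreal_measure) (simp add: less_top)
  have "U.energy p (0, 1) \<le> (\<integral>\<^sup>+z. ennreal (2 powr p) * (ennreal (s powr p) * ennreal (\<bar>U.pd (1, 0) z\<bar> powr p)
      + ennreal ((1 + s) powr p) * indicator (interior \<Omega>) z) \<partial>lborel)"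
    unfolding U.energy_def
  proof (intro nn_integral_mono_AE)
    show "AE z in lborel. ennreal (\<bar>U.pd (0, 1) z\<bar> powr p) \<le> ennreal (2 powr p) * (ennreal (s powr p) * ennreal (\<bar>U.pd (1, 0) z\<bar> powr p)
      + ennreal ((1 + s) powr p) * indicator (interior \<Omega>) z)"
      using U.AE_smooth
    proof eventually_elim
      case (elim z)
      show ?case
      proof (cases "z \<in> interior \<Omega>")
        case True
        have "\<bar>U.pd (0, 1) z\<bar> powr p \<le> (s * \<bar>U.pd (1, 0) z\<bar> + (1 + s)) powr p"
          using gradient_bound[OF N] elim True p by (intro powr_mono2) auto
        also have "\<dots> \<le> 2 powr p * ((s * \<bar>U.pd (1, 0) z\<bar>) powr p + (1 + s) powr p)"
          using pos p by (intro sum_powr_le) auto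
        finally have "ennreal (\<bar>U.pd (0, 1) z\<bar> powr p) \<le> ennreal (2 powr p * ((s * \<bar>U.pd (1, 0) z\<bar>) powr p + (1 + s) powr p))"
          by (rule ennreal_leI)
        then show ?thesis using pos True by (simp add: ennreal_mult powr_mult)
      qed (simp add: U.pd_def)
    qed
  qed
  also have "\<dots> = ennreal (2 powr p) * (ennreal (s powr p) * U.energy p (1, 0)
      + ennreal ((1 + s) powr p) * emeasure lborel (interior \<Omega>))"
    unfolding U.energy_def by (simp add: nn_integral_cmult nn_integral_add nn_integral_cmult_indicator)
  finally have "ennreal (energy_y p \<Omega> ?u) \<le> ennreal (2 powr p * (s powr p * energy_x p \<Omega> ?u + (1 + s) powr p * measure lborel (interior \<Omega>)))"
    unfolding concave_class_energy[OF cl domain p] fin using energy_nonneg(1)[of p \<Omega> ?u]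
    by (simp add: ennreal_mult[symmetric] ennreal_plus[symmetric] del: ennreal_plus)
  then show ?thesis using energy_nonneg(1)[of p \<Omega> ?u] by (subst (asm) ennreal_le_iff) auto
qed

text \<open>
  On these rows both ends of the chord are at vertical distance at least \<open>r / 4\<close>.
\<close>
definition rows :: "real set" where "rows = {snd A + r / 4..snd B - r / 4}"

text \<open>
  Every row contains an interior point well away from the support line: cut the segment from \<open>W\<close> to that
  end of the chord which lies on the other side of the row.
\<close>
lemma row_witness:
  assumes y: "y \<in> rows"
  obtains \<zeta> where "\<zeta> \<in> interior \<Omega>" "snd \<zeta> = y" "r * w / (4 * D) \<le> X \<zeta>"
proof -
  note witness = that
  have *: thesis if E: "E \<in> \<Omega>" and ne: "(snd E \<le> y - r / 4 \<and> y \<le> snd W) \<or> (y + r / 4 \<le> snd E \<and> snd W < y)" for E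
  proof -
    define t where "t = (y - snd E) / (snd W - snd E)"
    have ED: "\<bar>snd W - snd E\<bar> \<le> D" using D(2)[OF E] by (simp add: abs_minus_commute)
    have t: "t \<le> 1" "r / (4 * D) \<le> t"
    proof -
      have ne': "snd W - snd E \<noteq> 0" using ne pos by auto
      have tabs: "t = \<bar>y - snd E\<bar> / \<bar>snd W - snd E\<bar>"
      proof -
        have "0 \<le> t" using ne pos by (auto simp: t_def zero_le_divide_iff)
        then have "t = \<bar>t\<bar>" by simp
        then show ?thesis unfolding t_def abs_divide .
      qed
      have "\<bar>y - snd E\<bar> \<le> \<bar>snd W - snd E\<bar>" using ne pos by auto
      then show "t \<le> 1" unfolding tabs using ne' by (simp add: divide_le_eq)
      have "(r / 4) / D \<le> \<bar>y - snd E\<bar> / \<bar>snd W - snd E\<bar>"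
        using ne pos ED ne' by (intro frac_le) auto
      then show "r / (4 * D) \<le> t" unfolding tabs by simp
    qed
    have "0 < r / (4 * D)" using pos D by simp
    with t have t0: "0 < t" by linarith
    define \<zeta> where "\<zeta> = (1 - t) *\<^sub>R E + t *\<^sub>R W"
    have "E - t *\<^sub>R (E - W) \<in> interior \<Omega>"
      using t t0 by (intro mem_interior_convex_shrink conv(1) W E)
    then have "\<zeta> \<in> interior \<Omega>" by (simp add: \<zeta>_def algebra_simps)
    moreover have "snd \<zeta> = y"
    proof -
      have "snd \<zeta> = snd E + t * (snd W - snd E)" by (simp add: \<zeta>_def algebra_simps)
      also have "\<dots> = y" using ne pos by (auto simp: t_def)
      finally show ?thesis .
    qed
    moreover have "r * w / (4 * D) \<le> X \<zeta>"
    proof -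
      have "r * w / (4 * D) = r / (4 * D) * w" by simp
      also have "\<dots> \<le> t * w" using t pos by (intro mult_right_mono) auto
      also have "\<dots> \<le> X \<zeta>" unfolding \<zeta>_def X_convex w_def using X_nonneg[OF E] t by simp
      finally show ?thesis .
    qed
    ultimately show ?thesis by (rule witness)
  qed
  show ?thesis
    using *[OF A(1)] *[OF B(1)] y by (cases "y \<le> snd W") (auto simp: rows_def)
qed

text \<open>
  Near the arc the affine functions with normalised gradients are bounded below, since each of them can be
  compared with a point of \<open>\<Omega>\<close> towards which it decreases: the lower or upper end of the chord if the
  gradient has a substantial vertical part, and the point \<open>\<zeta>\<close> further inside on the same row otherwise.
\<close>
lemma second_kind_lower:
  assumes g: "\<bar>fst g\<bar> + \<bar>snd g\<bar> = 1" "\<not> (0 < \<sigma> * fst g \<and> \<bar>snd g\<bar> \<le> s * (\<sigma> * fst g))"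
    and z: "snd z \<in> rows" "0 \<le> X z" "X z \<le> r / 8" and \<zeta>: "\<zeta> \<in> \<Omega>" "snd \<zeta> = snd z" "X z + r * w / (8 * D) \<le> X \<zeta>"
  shows "\<exists>\<zeta>\<in>\<Omega>. c \<le> g \<bullet> (z - \<zeta>)"
proof -
  define \<gamma> where "\<gamma> = \<sigma> * fst g"
  have gabs: "\<bar>\<gamma>\<bar> + \<bar>snd g\<bar> = 1" using g(1) by (simp add: \<gamma>_def abs_mult \<sigma>2)
  \<comment> \<open>\<open>A\<close> lies below and \<open>B\<close> above the row of \<open>z\<close>, by at least \<open>r / 4\<close>\<close>
  define E where "E = (if 0 \<le> snd g then A else B)"
  have E: "E \<in> \<Omega>" "X E \<le> h * r" using A B XAB by (auto simp: E_def)
  have "\<bar>snd g\<bar> * (r / 4) \<le> snd g * (snd z - snd E)"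
  proof (cases "0 \<le> snd g")
    case True
    then have "snd g * (r / 4) \<le> snd g * (snd z - snd A)"
      using z(1) by (intro mult_left_mono) (auto simp: rows_def)
    then show ?thesis using True by (simp add: E_def)
  next
    case False
    then have "- snd g * (r / 4) \<le> - snd g * (snd B - snd z)"
      using z(1) by (intro mult_left_mono) (auto simp: rows_def)
    then show ?thesis using False by (simp add: E_def algebra_simps)
  qed
  then have gE: "\<gamma> * (X z - X E) + \<bar>snd g\<bar> * (r / 4) \<le> g \<bullet> (z - E)"
    unfolding inner_eq \<gamma>_def by simp
  consider "0 < \<gamma>" | "\<gamma> \<le> 0" "1 / 2 \<le> \<bar>snd g\<bar>" | "\<gamma> \<le> - 1 / 2" using gabs by argo
  then show ?thesis
  proof cases
    case 1
    then have steep: "s * \<gamma> < \<bar>snd g\<bar>" using g(2) by (auto simp: \<gamma>_def)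
    have "\<gamma> * - (h * r) \<le> \<gamma> * (X z - X E)" using 1 E z by (intro mult_left_mono) auto
    moreover have "\<gamma> * (h * r) \<le> \<bar>snd g\<bar> * (r / 8)"
      using mult_right_mono[OF less_imp_le[OF steep], of "r / 8"] pos by (simp add: s_def algebra_simps)
    ultimately have "\<bar>snd g\<bar> * (r / 8) \<le> g \<bullet> (z - E)" using gE by (simp add: algebra_simps)
    moreover have "s / 2 \<le> \<bar>snd g\<bar>"
    proof -
      have "s * 1 = s * \<gamma> + s * \<bar>snd g\<bar>" using gabs 1 by (simp add: distrib_left[symmetric])
      also have "s * \<bar>snd g\<bar> \<le> 1 * \<bar>snd g\<bar>" using pos by (intro mult_right_mono) auto
      finally show ?thesis using steep by linarith
    qed
    then have "s / 2 * (r / 8) \<le> \<bar>snd g\<bar> * (r / 8)" using pos by (intro mult_right_mono) auto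
    moreover have "c \<le> s / 2 * (r / 8)" by (simp add: c_def s_def mult.commute)
    ultimately show ?thesis using E by force
  next
    case 2
    have "\<bar>\<gamma>\<bar> * X z \<le> 1 / 2 * (r / 8)" using 2 gabs z pos by (intro mult_mono) auto
    moreover have "\<gamma> * X E \<le> 0" using 2 X_nonneg[OF E(1)] by (simp add: mult_nonpos_nonneg)
    moreover have "\<bar>\<gamma>\<bar> * X z = - \<gamma> * X z" using 2 by simp
    moreover have "1 / 2 * (r / 4) \<le> \<bar>snd g\<bar> * (r / 4)" using 2 pos by (intro mult_right_mono) auto
    ultimately have "r / 16 \<le> g \<bullet> (z - E)" using gE by (simp add: algebra_simps)
    moreover have "c \<le> r / 16" by (simp add: c_def)
    ultimately show ?thesis using E by force
  next
    case 3
    have rw: "0 \<le> r * w / (8 * D)" using pos D by simp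
    have "1 / 2 * (r * w / (8 * D)) \<le> - \<gamma> * (X \<zeta> - X z)"
      using 3 \<zeta>(3) rw by (intro mult_mono) auto
    also have "\<dots> = g \<bullet> (z - \<zeta>)" unfolding inner_eq \<gamma>_def using \<zeta>(2) by (simp add: algebra_simps)
    finally have "r * w / (16 * D) \<le> g \<bullet> (z - \<zeta>)" by simp
    moreover have "c \<le> r * w / (16 * D)" by (simp add: c_def)
    ultimately show ?thesis using \<zeta>(1) by force
  qed
qed

text \<open>
  On the row at height \<open>y\<close>, the envelope vanishes at the boundary point \<open>l\<close> next to the support line and is
  at least \<open>c\<close> at distance \<open>\<tau> = c / N\<close> from it: steep members gain \<open>N * \<tau>\<close>, the others are covered by
  \<open>second_kind_lower\<close>. The least energy for such a climb is \<open>c powr p * \<tau> powr (1 - p)\<close>.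
\<close>
lemma row_energy:
  assumes N: "1 \<le> N" and p: "1 < p" and y: "y \<in> rows"
  defines "u \<equiv> envelope (G N) \<Omega>"
  shows "ennreal (c * N powr (p - 1)) \<le>
     (\<integral>\<^sup>+x. ennreal (\<bar>concave_fun.pd (interior \<Omega>) u (1, 0) (x, y)\<bar> powr p) \<partial>lborel)"
    and "\<exists>z\<in>\<Omega>. u z \<noteq> 0"
proof -
  interpret E: bounded_gradients "G N" \<Omega> "2 * N" by (rule bounded_gradients_G[OF N])
  note cl = envelope_class[OF N, folded u_def]
  interpret U: concave_plane "interior \<Omega>" u
    by (rule concave_class_plane[OF cl conv(1)])
  have cont: "continuous_on \<Omega> u" using cl by (simp add: concave_class_def)
  obtain \<zeta> where \<zeta>: "\<zeta> \<in> interior \<Omega>" "snd \<zeta> = y" "r * w / (4 * D) \<le> X \<zeta>" using row_witness[OF y] .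
  have \<zeta>\<Omega>: "\<zeta> \<in> \<Omega>" using \<zeta>(1) interior_subset by auto
  have dir: "(- \<sigma>, 0) \<noteq> (0 :: real \<times> real)" using \<sigma> by (auto simp: zero_prod_def)
  obtain t0 where t0: "0 < t0" "\<zeta> + t0 *\<^sub>R (- \<sigma>, 0) \<in> frontier \<Omega>"
      "\<And>t. 0 \<le> t \<Longrightarrow> t < t0 \<Longrightarrow> \<zeta> + t *\<^sub>R (- \<sigma>, 0) \<in> interior \<Omega>"
    using ray_to_frontier[OF compact_imp_bounded[OF conv(2)] \<zeta>(1) dir] by metis
  define l where "l = \<zeta> + t0 *\<^sub>R (- \<sigma>, 0)"
  have l\<Omega>: "l \<in> \<Omega>" and lf: "l \<in> frontier \<Omega>" and ul: "u l = 0"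
    using t0(2) frontier_subset_closed[OF conv(4)] cl by (auto simp: l_def concave_class_def)
  have Xray: "X (q + t *\<^sub>R (- \<sigma>, 0)) = X q - t" for q t
    by (simp add: X_def algebra_simps \<sigma>2)
  have Xl: "X l = X \<zeta> - t0" unfolding l_def by (rule Xray)
  have snd_l: "snd l = y" using \<zeta>(2) by (simp add: l_def)
  have Xl_le: "X l \<le> h * r"
  proof (rule ccontr)
    assume n: "\<not> X l \<le> h * r"
    \<comment> \<open>\<open>l\<close> would lie strictly between the chord point \<open>q\<close> and the interior point \<open>\<zeta>\<close>\<close>
    define k where "k = (y - snd A) / r"
    have "snd A + r / 4 \<le> y" "y \<le> snd B - r / 4" using y by (auto simp: rows_def)
    then have "0 \<le> y - snd A" "y - snd A \<le> r" using pos(1) r_def by linarith+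
    then have k: "0 \<le> k" "k \<le> 1" using pos by (auto simp: k_def)
    define q where "q = (1 - k) *\<^sub>R A + k *\<^sub>R B"
    have q: "q \<in> \<Omega>" using convexD_alt[OF conv(1) A(1) B(1) k] by (simp add: q_def)
    have "X q \<le> (1 - k) * (h * r) + k * (h * r)"
      unfolding q_def X_convex using XAB k by (intro add_mono mult_left_mono) auto
    then have Xq: "X q < X l" using n by (simp add: algebra_simps)
    have "snd q = snd A + k * r" by (simp add: q_def r_def algebra_simps)
    then have sq: "snd q = y" using pos by (simp add: k_def)
    define t where "t = (X l - X q) / (X \<zeta> - X q)"
    have t: "0 < t" "t \<le> 1" "(X \<zeta> - X q) * t = X l - X q" using Xq Xl t0(1) by (auto simp: t_def)
    have "q - t *\<^sub>R (q - \<zeta>) \<in> interior \<Omega>"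
      using t by (intro mem_interior_convex_shrink conv(1) \<zeta>(1) q)
    moreover have "q - t *\<^sub>R (q - \<zeta>) = l"
    proof -
      have "X (q - t *\<^sub>R (q - \<zeta>)) = X ((1 - t) *\<^sub>R q + t *\<^sub>R \<zeta>)" by (simp add: algebra_simps)
      also have "\<dots> = X l" unfolding X_convex using t(3) by (simp add: algebra_simps)
      finally have "fst (q - t *\<^sub>R (q - \<zeta>)) = fst l" using \<sigma> by (auto simp: X_def)
      then show ?thesis using sq \<zeta>(2) snd_l by (simp add: prod_eq_iff)
    qed
    ultimately show False using lf by (simp add: frontier_def)
  qed
  define \<tau> where "\<tau> = c / N"
  have \<tau>: "0 < \<tau>" "\<tau> \<le> c" "N * \<tau> = c" using pos N by (auto simp: \<tau>_def divide_le_eq mult_left_mono)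
  have c_le: "c \<le> r / 16" "c \<le> r * w / (16 * D)" by (auto simp: c_def)
  have rw: "r * w / (4 * D) = 4 * (r * w / (16 * D))" "r * w / (8 * D) = 2 * (r * w / (16 * D))"
    "0 < r * w / (16 * D)" using pos D by auto
  have \<tau>t0: "\<tau> < t0" using Xl Xl_le \<zeta>(3) hr_le \<tau> c_le rw by linarith
  define z where "z = l + \<tau> *\<^sub>R (\<sigma>, 0)"
  have on_ray: "l + t *\<^sub>R (\<sigma>, 0) = \<zeta> + (t0 - t) *\<^sub>R (- \<sigma>, 0)" for t
    by (simp add: l_def algebra_simps)
  have inside: "l + t *\<^sub>R (\<sigma>, 0) \<in> interior \<Omega>" if "0 < t" "t \<le> \<tau>" for t
    unfolding on_ray using that \<tau>t0 by (intro t0(3)) auto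
  have z\<Omega>: "z \<in> \<Omega>" using inside[of \<tau>] \<tau> interior_subset by (auto simp: z_def)
  have Xz: "X z = X l + \<tau>" unfolding z_def using Xray[of l "- \<tau>"] by simp
  have snd_z: "snd z = y" by (simp add: z_def snd_l)
  have "c \<le> u z" unfolding u_def
  proof (rule E.envelope_ge)
    fix g assume "g \<in> G N"
    then show "\<exists>\<zeta>\<in>\<Omega>. c \<le> g \<bullet> (z - \<zeta>)"
    proof (unfold G_def, elim UnE CollectE conjE)
      assume g: "fst g = \<sigma> * N"
      have "g \<bullet> (z - l) = (\<sigma> * \<sigma>) * N * \<tau>" unfolding inner_eq Xz snd_z snd_l g by simp
      then show ?thesis using l\<Omega> \<tau>(3) \<sigma>2 by (intro bexI[of _ l]) auto
    next
      assume g: "\<bar>fst g\<bar> + \<bar>snd g\<bar> = 1" "\<not> (0 < \<sigma> * fst g \<and> \<bar>snd g\<bar> \<le> s * (\<sigma> * fst g))"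
      have "X z \<le> r / 8" "X z + r * w / (8 * D) \<le> X \<zeta>"
        using Xz Xl_le hr_le \<tau> c_le rw \<zeta>(3) by linarith+
      then show ?thesis
        using X_nonneg[OF z\<Omega>] \<zeta>(2) y snd_z
        by (intro second_kind_lower[OF g _ _ _ \<zeta>\<Omega>]) auto
    qed
  qed
  then show "\<exists>z\<in>\<Omega>. u z \<noteq> 0" using z\<Omega> pos by force
  have "ennreal (c * N powr (p - 1)) \<le> ennreal (\<bar>u z - u l\<bar> powr p * \<tau> powr (1 - p))"
  proof (rule ennreal_leI)
    have "c * N powr (p - 1) = c powr p * \<tau> powr (1 - p)"
    proof -
      have "\<tau> powr (1 - p) = c powr (1 - p) * N powr (p - 1)"
        using pos N by (simp add: \<tau>_def powr_divide powr_diff)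
      moreover have "c powr p * c powr (1 - p) = c" using pos by (simp add: powr_add[symmetric])
      ultimately show ?thesis by (simp add: mult.assoc[symmetric])
    qed
    also have "\<dots> \<le> \<bar>u z - u l\<bar> powr p * \<tau> powr (1 - p)"
      using \<open>c \<le> u z\<close> pos p ul by (intro mult_right_mono powr_mono2) auto
    finally show "c * N powr (p - 1) \<le> \<bar>u z - u l\<bar> powr p * \<tau> powr (1 - p)" .
  qed
  also have "\<dots> \<le> (\<integral>\<^sup>+x. ennreal (\<bar>U.pd (1, 0) (x, y)\<bar> powr p) \<partial>lborel)"
  proof -
    \<comment> \<open>the order of \<open>l\<close> and \<open>z\<close> on the row depends on \<open>\<sigma>\<close>\<close>
    define a' where "a' = min (fst l) (fst z)"
    have az: "a' + \<tau> = max (fst l) (fst z)" using \<sigma> \<tau> by (auto simp: a'_def z_def)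
    have pts: "\<exists>t. 0 \<le> t \<and> t \<le> \<tau> \<and> (x, y) = l + t *\<^sub>R (\<sigma>, 0) \<and> (a' < x \<and> x < a' + \<tau> \<longrightarrow> 0 < t)" if "x \<in> {a'..a' + \<tau>}" for x
      using that \<sigma> \<tau> snd_l by (intro exI[of _ "\<sigma> * (x - fst l)"]) (auto simp: a'_def z_def prod_eq_iff)
    have "continuous_on {a'..a' + \<tau>} (\<lambda>x. u (x, y))"
    proof (intro continuous_on_compose2[OF cont, of _ "\<lambda>x. (x, y)"] continuous_on_Pair continuous_on_const continuous_on_id)
      show "(\<lambda>x. (x, y)) ` {a'..a' + \<tau>} \<subseteq> \<Omega>"
      proof clarify
        fix x assume "x \<in> {a'..a' + \<tau>}"
        then obtain t where "0 \<le> t" "t \<le> \<tau>" "(x, y) = l + t *\<^sub>R (\<sigma>, 0)" using pts by blast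
        then show "(x, y) \<in> \<Omega>" using inside[of t] interior_subset[of \<Omega>] l\<Omega> by (cases "t = 0") (auto simp flip: zero_prod_def)
      qed
    qed
    moreover have "(x, y) \<in> interior \<Omega>" if "a' < x" "x < a' + \<tau>" for x
      using pts[of x] that inside by force
    ultimately have "ennreal (\<bar>u (a' + \<tau>, y) - u (a', y)\<bar> powr p * \<tau> powr (1 - p))
        \<le> (\<integral>\<^sup>+x. ennreal (\<bar>U.pd (1, 0) (x, y)\<bar> powr p) \<partial>lborel)"
      using U.segment_energy[of a' "a' + \<tau>" p "(0, y)" "(1, 0)"] \<tau> p by simp
    moreover have "\<bar>u (a' + \<tau>, y) - u (a', y)\<bar> = \<bar>u z - u l\<bar>"
      unfolding az unfolding a'_def
      using snd_l snd_z by (cases z; cases l) (auto simp: min_def max_def abs_minus_commute)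
    ultimately show ?thesis by simp
  qed
  finally show "ennreal (c * N powr (p - 1)) \<le> (\<integral>\<^sup>+x. ennreal (\<bar>U.pd (1, 0) (x, y)\<bar> powr p) \<partial>lborel)" .
qed

lemma energy_x_lower:
  assumes N: "1 \<le> N" and p: "1 < p"
  shows "r / 2 * c * N powr (p - 1) \<le> energy_x p \<Omega> (envelope (G N) \<Omega>)"
proof -
  let ?u = "envelope (G N) \<Omega>"
  note cl = envelope_class[OF N]
  interpret U: concave_plane "interior \<Omega>" ?u
    by (rule concave_class_plane[OF cl conv(1)])
  have "emeasure lborel rows = ennreal (r / 2)"
  proof -
    have "emeasure lborel rows = ennreal ((snd B - r / 4) - (snd A + r / 4))"
      unfolding rows_def by (rule emeasure_lborel_Icc) (use pos in \<open>simp add: r_def field_simps\<close>)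
    also have "(snd B - r / 4) - (snd A + r / 4) = r / 2" by (simp add: r_def field_simps)
    finally show ?thesis .
  qed
  then have "ennreal (r / 2 * c * N powr (p - 1)) = ennreal (c * N powr (p - 1)) * emeasure lborel rows"
    using pos by (simp add: ennreal_mult[symmetric] mult_ac)
  also have "\<dots> = (\<integral>\<^sup>+y. ennreal (c * N powr (p - 1)) * indicator rows y \<partial>lborel)"
    by (subst nn_integral_cmult_indicator) (auto simp: rows_def)
  also have "\<dots> \<le> U.energy p (1, 0)" unfolding U.energy_x
    using row_energy(1)[OF N p] by (intro nn_integral_mono) (simp add: indicator_def)
  also have "\<dots> = ennreal (energy_x p \<Omega> ?u)" by (rule concave_class_energy[OF cl domain p])
  finally show ?thesis using energy_nonneg(1)[of p \<Omega> ?u] by (subst (asm) ennreal_le_iff) auto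
qed

lemma nonzero_envelope:
  assumes N: "1 \<le> N"
  shows "\<exists>z\<in>\<Omega>. envelope (G N) \<Omega> z \<noteq> 0"
proof -
  have "(snd A + snd B) / 2 \<in> rows" using pos by (simp add: rows_def r_def field_simps)
  then show ?thesis using row_energy(2)[OF N, of 2] by simp
qed

text \<open>
  If \<open>E\<^sub>x \<le> k * E\<^sub>y\<close>, then the bound on \<open>E\<^sub>y\<close> by \<open>E\<^sub>x\<close> absorbs half of \<open>E\<^sub>x\<close> and leaves an estimate of \<open>E\<^sub>x\<close>
  that does not depend on \<open>N\<close>.
\<close>
lemma ratio_unbounded:
  assumes p: "1 < p" and k: "0 \<le> k" "k * (2 powr p * s powr p) \<le> 1 / 2"
  shows "\<exists>u\<in>concave_class \<Omega>. (\<exists>z\<in>\<Omega>. u z \<noteq> 0) \<and> k * energy_y p \<Omega> u < energy_x p \<Omega> u"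
proof (rule ccontr)
  assume "\<not> ?thesis"
  then have no: "energy_x p \<Omega> u \<le> k * energy_y p \<Omega> u" if "u \<in> concave_class \<Omega>" "\<exists>z\<in>\<Omega>. u z \<noteq> 0" for u
    using that by force
  define Q where "Q = 2 * (k * (2 powr p * ((1 + s) powr p * measure lborel (interior \<Omega>))))"
  have bound: "r / 2 * c * N powr (p - 1) \<le> Q" if N: "1 \<le> N" for N
  proof -
    let ?X = "energy_x p \<Omega> (envelope (G N) \<Omega>)"
    have "?X \<le> k * energy_y p \<Omega> (envelope (G N) \<Omega>)"
      by (rule no[OF envelope_class[OF N] nonzero_envelope[OF N]])
    also have "\<dots> \<le> k * (2 powr p * (s powr p * ?X + (1 + s) powr p * measure lborel (interior \<Omega>)))"
      by (intro mult_left_mono energy_y_bound N p k)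
    also have "\<dots> = k * (2 powr p * s powr p) * ?X + Q / 2"
      by (simp add: Q_def algebra_simps)
    also have "k * (2 powr p * s powr p) * ?X \<le> 1 / 2 * ?X"
      by (intro mult_right_mono k energy_nonneg)
    finally show ?thesis using energy_x_lower[OF N p] by linarith
  qed
  define M where "M = max 1 (Q / (r / 2 * c) + 1)"
  \<comment> \<open>chosen so that \<open>N powr (p - 1)\<close> equals \<open>M\<close>\<close>
  define N where "N = M powr (1 / (p - 1))"
  have "1 \<le> N" using p by (simp add: N_def M_def ge_one_powr_ge_zero)
  moreover have "N powr (p - 1) = M" using p by (simp add: N_def powr_powr M_def)
  ultimately have "r / 2 * c * M \<le> Q" using bound[of N] by simp
  moreover have "0 < r / 2 * c" using pos by simp
  ultimately have "M \<le> Q / (r / 2 * c)" by (simp add: pos_le_divide_eq mult.commute)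
  then show False by (simp add: M_def)
qed

end

section \<open>Angular lines and slopes\<close>

lemma supporting_inner_frontier:
  fixes a :: "'a::euclidean_space"
  assumes "a \<noteq> 0" "\<Omega> \<subseteq> {z. a \<bullet> z \<le> b}" "\<xi> \<in> \<Omega>" "a \<bullet> \<xi> = b"
  shows "\<xi> \<in> frontier \<Omega>"
proof -
  have "\<xi> \<notin> interior \<Omega>"
  proof
    assume "\<xi> \<in> interior \<Omega>"
    then have "\<xi> \<in> interior {z. a \<bullet> z \<le> b}" using interior_mono[OF assms(2)] by blast
    then show False using assms(1,4) by simp
  qed
  then show ?thesis using assms(3) closure_subset by (auto simp: frontier_def)
qed

lemma vertical_support_line_iff:
  "vertical_line L \<and> support_line \<Omega> L \<longleftrightarrow>
    (\<exists>a \<sigma>. (\<sigma> = 1 \<or> \<sigma> = -1) \<and> L = {z. fst z = a} \<and> L \<inter> \<Omega> \<noteq> {} \<and> (\<forall>z\<in>\<Omega>. 0 \<le> \<sigma> * (fst z - a)))"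
  (is "?V \<longleftrightarrow> ?S")
proof
  assume ?V
  then obtain a v b where L: "L = {z. fst z = a}" "L \<inter> \<Omega> \<noteq> {}" "v \<noteq> 0" "L = {z. v \<bullet> z = b}"
    and sub: "\<Omega> \<subseteq> {z. v \<bullet> z \<le> b}"
    unfolding vertical_line_def support_line_def by blast
  have "(a, 0) \<in> L" "(a, 1) \<in> L" using L(1) by auto
  then have "v \<bullet> (a, 0) = b" "v \<bullet> (a, 1) = b" using L(4) by auto
  then have v: "snd v = 0" "b = fst v * a" by (auto simp: inner_prod_def)
  then have v0: "fst v \<noteq> 0" using L(3) by (auto simp: prod_eq_iff)
  define \<sigma> where "\<sigma> = - sgn (fst v)"
  have "0 \<le> \<sigma> * (fst z - a)" if "z \<in> \<Omega>" for z
  proof -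
    have "fst v * (fst z - a) \<le> 0" using sub that v by (auto simp: inner_prod_def algebra_simps)
    then show ?thesis by (auto simp: \<sigma>_def sgn_if mult_le_0_iff)
  qed
  moreover have "\<sigma> = 1 \<or> \<sigma> = -1" using v0 by (auto simp: \<sigma>_def sgn_if)
  ultimately show ?S using L by blast
next
  assume ?S
  then obtain a \<sigma> where \<sigma>: "\<sigma> = 1 \<or> \<sigma> = -1" and L: "L = {z. fst z = a}" "L \<inter> \<Omega> \<noteq> {}"
    and side: "\<And>z. z \<in> \<Omega> \<Longrightarrow> 0 \<le> \<sigma> * (fst z - a)" by blast
  have "(- \<sigma>, 0) \<noteq> (0 :: real \<times> real)" using \<sigma> by (auto simp: zero_prod_def)
  moreover have "L = {z. (- \<sigma>, 0) \<bullet> z = - \<sigma> * a}" using \<sigma> L by (auto simp: inner_prod_def)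
  moreover have "\<Omega> \<subseteq> {z. (- \<sigma>, 0) \<bullet> z \<le> - \<sigma> * a}" using side by (auto simp: inner_prod_def algebra_simps)
  ultimately show ?V using L unfolding vertical_line_def support_line_def by blast
qed

text \<open>
  Since the points straight above and below \<open>\<xi>\<close> are outside the tangent cone, there are support lines at
  \<open>\<xi>\<close> that cut them off; their slopes give \<open>M\<close>.
\<close>
lemma angular_imp_cone:
  assumes \<Omega>: "convex_compact_domain \<Omega>" and \<sigma>: "\<sigma> = 1 \<or> \<sigma> = -1"
    and side: "\<And>z. z \<in> \<Omega> \<Longrightarrow> 0 \<le> \<sigma> * (fst z - a)"
    and ang: "angular_support_line \<Omega> {z. fst z = a}"
  obtains \<xi> M where "\<xi> \<in> \<Omega>" "fst \<xi> = a" "0 < M"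
    "\<And>z. z \<in> \<Omega> \<Longrightarrow> \<bar>snd z - snd \<xi>\<bar> \<le> M * (\<sigma> * (fst z - a))"
proof -
  obtain \<xi> where \<xi>: "singular_point \<Omega> \<xi>" "{z. fst z = a} \<inter> tangent_cone \<Omega> \<xi> = {\<xi>}"
    using ang by (auto simp: angular_support_line_def)
  have "closed \<Omega>" using \<Omega> by (auto simp: convex_compact_domain_def compact_imp_closed)
  then have \<xi>\<Omega>: "\<xi> \<in> \<Omega>" using \<xi>(1) frontier_subset_closed by (auto simp: singular_point_def)
  have \<xi>a: "fst \<xi> = a" using \<xi>(2) by blast
  have slope: "\<exists>m. \<forall>z\<in>\<Omega>. e * (snd z - snd \<xi>) \<le> m * (\<sigma> * (fst z - a))" if e: "e = 1 \<or> e = -1" for e :: real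
  proof -
    have "\<xi> + (0, e) \<notin> tangent_cone \<Omega> \<xi>"
    proof
      assume "\<xi> + (0, e) \<in> tangent_cone \<Omega> \<xi>"
      then have "\<xi> + (0, e) \<in> {\<xi>}" unfolding \<xi>(2)[symmetric] using \<xi>a by simp
      then show False using e by (auto simp: prod_eq_iff)
    qed
    then obtain v where v: "\<Omega> \<subseteq> {z. v \<bullet> z \<le> v \<bullet> \<xi>}" "\<not> v \<bullet> (\<xi> + (0, e)) \<le> v \<bullet> \<xi>"
      by (auto simp: tangent_cone_def)
    define n where "n = snd v * e"
    have n: "0 < n" using v(2) by (simp add: n_def inner_prod_def distrib_left)
    have "e * (snd z - snd \<xi>) \<le> (- \<sigma> * fst v / n) * (\<sigma> * (fst z - a))" if z: "z \<in> \<Omega>" for z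
    proof -
      have "snd v * (snd z - snd \<xi>) \<le> - fst v * (fst z - a)"
        using v(1) z \<xi>a by (auto simp: inner_prod_def algebra_simps)
      also have "snd v = n * e" using e by (auto simp: n_def)
      finally have "n * (e * (snd z - snd \<xi>)) \<le> - fst v * (fst z - a)" by (simp add: mult.assoc)
      then have "e * (snd z - snd \<xi>) \<le> (- fst v * (fst z - a)) / n" using n by (simp only: pos_le_divide_eq mult.commute[of _ n])
      also have "\<dots> = (- \<sigma> * fst v / n) * (\<sigma> * (fst z - a))" using \<sigma> by auto
      finally show ?thesis .
    qed
    then show ?thesis by blast
  qed
  obtain m1 where m1: "\<And>z. z \<in> \<Omega> \<Longrightarrow> snd z - snd \<xi> \<le> m1 * (\<sigma> * (fst z - a))" using slope[of 1] by auto
  obtain m2 where m2: "\<And>z. z \<in> \<Omega> \<Longrightarrow> - (snd z - snd \<xi>) \<le> m2 * (\<sigma> * (fst z - a))" using slope[of "-1"] by auto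
  define M where "M = \<bar>m1\<bar> + \<bar>m2\<bar> + 1"
  have "\<bar>snd z - snd \<xi>\<bar> \<le> M * (\<sigma> * (fst z - a))" if z: "z \<in> \<Omega>" for z
  proof -
    have "m1 * (\<sigma> * (fst z - a)) \<le> M * (\<sigma> * (fst z - a))" "m2 * (\<sigma> * (fst z - a)) \<le> M * (\<sigma> * (fst z - a))"
      using side[OF z] by (intro mult_right_mono; simp add: M_def)+
    then show ?thesis using m1[OF z] m2[OF z] by linarith
  qed
  moreover have "0 < M" by (simp add: M_def)
  ultimately show ?thesis using that \<xi>\<Omega> \<xi>a by blast
qed

text \<open>
  The two sides of the cone are support lines at \<open>\<xi>\<close>. They make \<open>\<xi>\<close> singular and confine its tangent cone.
\<close>
lemma cone_imp_angular:
  assumes \<sigma>: "\<sigma> = 1 \<or> \<sigma> = -1" and h: "0 < h" and \<xi>: "\<xi> \<in> \<Omega>" "fst \<xi> = a"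
    and cone: "\<And>z. z \<in> \<Omega> \<Longrightarrow> h * \<bar>snd z - snd \<xi>\<bar> \<le> \<sigma> * (fst z - a)"
  shows "angular_support_line \<Omega> {z. fst z = a}"
proof -
  define v where "v e = (- \<sigma>, e * h)" for e :: real
  have v0: "v e \<noteq> 0" for e using \<sigma> by (auto simp: v_def prod_eq_iff)
  have vz: "v e \<bullet> z - v e \<bullet> \<xi> = e * h * (snd z - snd \<xi>) - \<sigma> * (fst z - a)" for e z
    by (simp add: v_def inner_prod_def \<xi>(2)[symmetric] algebra_simps)
  have sub: "\<Omega> \<subseteq> {z. v e \<bullet> z \<le> v e \<bullet> \<xi>}" if e: "e = 1 \<or> e = -1" for e
  proof clarify
    fix x y assume "(x, y) \<in> \<Omega>"
    moreover have "e * h * (y - snd \<xi>) \<le> h * \<bar>y - snd \<xi>\<bar>"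
      using e h by (auto simp: abs_if mult_le_cancel_left)
    ultimately have "v e \<bullet> (x, y) - v e \<bullet> \<xi> \<le> 0" unfolding vz using cone[of "(x, y)"] by simp
    then show "v e \<bullet> (x, y) \<le> v e \<bullet> \<xi>" by simp
  qed
  have sup: "support_line \<Omega> {z. v e \<bullet> z = v e \<bullet> \<xi>}" if "e = 1 \<or> e = -1" for e
    unfolding support_line_def using \<xi>(1) v0[of e] sub[OF that] by blast
  have ne: "{z. v 1 \<bullet> z = v 1 \<bullet> \<xi>} \<noteq> {z. v (-1) \<bullet> z = v (-1) \<bullet> \<xi>}"
  proof -
    define q where "q = \<xi> + (\<sigma> * h, 1)"
    have "v 1 \<bullet> q - v 1 \<bullet> \<xi> = 0" "v (-1) \<bullet> q - v (-1) \<bullet> \<xi> \<noteq> 0"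
      unfolding vz using \<sigma> h \<xi>(2) by (auto simp: q_def)
    then show ?thesis by auto
  qed
  have sing: "singular_point \<Omega> \<xi>"
    unfolding singular_point_def
  proof (intro conjI exI)
    show "\<xi> \<in> frontier \<Omega>" by (rule supporting_inner_frontier[OF v0 sub[of 1] \<xi>(1)]) auto
    show "{z. v 1 \<bullet> z = v 1 \<bullet> \<xi>} \<noteq> {z. v (-1) \<bullet> z = v (-1) \<bullet> \<xi>}" by (rule ne)
  qed (auto intro!: sup)
  have "{z. fst z = a} \<inter> tangent_cone \<Omega> \<xi> = {\<xi>}"
  proof (intro equalityI subsetI)
    fix z assume z: "z \<in> {z. fst z = a} \<inter> tangent_cone \<Omega> \<xi>"
    have "v e \<bullet> z - v e \<bullet> \<xi> \<le> 0" if e: "e = 1 \<or> e = -1" for e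
    proof -
      have "tangent_cone \<Omega> \<xi> \<subseteq> {w. v e \<bullet> w \<le> v e \<bullet> \<xi>}"
        unfolding tangent_cone_def by (rule Inter_lower) (use v0[of e] sub[OF e] sup[OF e] in blast)
      then show ?thesis using z by auto
    qed
    from this[of 1] this[of "-1"] have "h * (snd z - snd \<xi>) \<le> 0" "- (h * (snd z - snd \<xi>)) \<le> 0"
      unfolding vz using z by auto
    then have "h * (snd z - snd \<xi>) = 0" by linarith
    then show "z \<in> {\<xi>}" using h z \<xi>(2) by (simp add: prod_eq_iff)
  next
    fix z assume "z \<in> {\<xi>}"
    then show "z \<in> {z. fst z = a} \<inter> tangent_cone \<Omega> \<xi>" using \<xi>(2) by (auto simp: tangent_cone_def)
  qed
  moreover have "is_line {z :: real \<times> real. fst z = a}"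
    unfolding is_line_def by (rule exI[of _ "(1, 0)"], rule exI[of _ a]) (auto simp: inner_prod_def zero_prod_def)
  ultimately show ?thesis using sing unfolding angular_support_line_def by blast
qed

text \<open>
  Otherwise \<open>\<Omega>\<close> would lie in a cone with vertex \<open>\<xi>\<close>. The point that violates the cone condition forms the
  chord together with \<open>\<xi>\<close> itself.
\<close>
lemma not_angular_imp_steep:
  assumes \<sigma>: "\<sigma> = 1 \<or> \<sigma> = -1" and \<xi>: "\<xi> \<in> \<Omega>" "fst \<xi> = a" and h: "0 < h"
    and side: "\<And>z. z \<in> \<Omega> \<Longrightarrow> 0 \<le> \<sigma> * (fst z - a)"
    and na: "\<not> angular_support_line \<Omega> {z. fst z = a}"
  obtains A B where "A \<in> \<Omega>" "B \<in> \<Omega>" "snd A < snd B"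
    "\<sigma> * (fst A - a) \<le> h * (snd B - snd A)" "\<sigma> * (fst B - a) \<le> h * (snd B - snd A)"
proof -
  obtain z where z: "z \<in> \<Omega>" "\<sigma> * (fst z - a) < h * \<bar>snd z - snd \<xi>\<bar>"
    using cone_imp_angular[OF \<sigma> h \<xi>] na by force
  have neg: "0 \<le> \<sigma> * (fst z - a)" by (rule side[OF z(1)])
  have \<xi>0: "\<sigma> * (fst \<xi> - a) = 0" using \<xi>(2) by simp
  show ?thesis
  proof (cases "snd \<xi> \<le> snd z")
    case True
    then have "snd \<xi> < snd z" using z(2) neg by (cases "snd \<xi> = snd z") auto
    then show ?thesis using z \<xi>(1) \<xi>0 h by (intro that[of \<xi> z]) auto
  next
    case False
    then show ?thesis using z \<xi>(1) \<xi>0 h by (intro that[of z \<xi>]) auto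
  qed
qed

theorem theorem6:
  fixes p :: real and \<Omega> :: "(real \<times> real) set"
  assumes "1 < p" and "convex_compact_domain \<Omega>"
  shows "K p \<Omega> < \<infinity> \<longleftrightarrow>
    (\<forall>L. vertical_line L \<and> support_line \<Omega> L \<longrightarrow> angular_support_line \<Omega> L)"
proof -
  note p = assms(1) and \<Omega> = assms(2)
  have c: "compact \<Omega>" "\<Omega> \<noteq> {}" "interior \<Omega> \<noteq> {}" using \<Omega> by (auto simp: convex_compact_domain_def)
  show ?thesis
  proof
    assume "K p \<Omega> < \<infinity>"
    then obtain k where k: "k \<ge> 0" "\<And>u. u \<in> concave_class \<Omega> \<Longrightarrow> \<exists>z\<in>\<Omega>. u z \<noteq> 0 \<Longrightarrow>
        energy_x p \<Omega> u \<le> k * energy_y p \<Omega> u"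
      using K_finite_iff[OF \<Omega> p] by blast
    show "\<forall>L. vertical_line L \<and> support_line \<Omega> L \<longrightarrow> angular_support_line \<Omega> L"
    proof (intro allI impI, rule ccontr)
      fix L assume "vertical_line L \<and> support_line \<Omega> L" and na: "\<not> angular_support_line \<Omega> L"
      then obtain a \<sigma> where \<sigma>: "\<sigma> = 1 \<or> \<sigma> = -1" and L: "L = {z. fst z = a}" "L \<inter> \<Omega> \<noteq> {}"
        and side: "\<And>z. z \<in> \<Omega> \<Longrightarrow> 0 \<le> \<sigma> * (fst z - a)"
        unfolding vertical_support_line_iff by blast
      obtain \<xi> where \<xi>: "\<xi> \<in> \<Omega>" "fst \<xi> = a" using L by auto
      obtain W where W: "W \<in> interior \<Omega>" using c by auto
      have Wpos: "0 < \<sigma> * (fst W - a)"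
      proof -
        have "\<Omega> \<subseteq> {z. (\<sigma>, 0) \<bullet> z \<ge> \<sigma> * a}" using side by (auto simp: inner_prod_def algebra_simps)
        then have int: "W \<in> interior {z. (\<sigma>, 0) \<bullet> z \<ge> \<sigma> * a}" using W interior_mono by blast
        have ne: "(\<sigma>, 0) \<noteq> (0 :: real \<times> real)" using \<sigma> by (auto simp: zero_prod_def)
        have "\<sigma> * a < (\<sigma>, 0) \<bullet> W" using int unfolding interior_halfspace_ge[OF ne] by blast
        then show ?thesis by (simp add: inner_prod_def algebra_simps)
      qed
      obtain D where D: "0 < D" "\<And>z. z \<in> \<Omega> \<Longrightarrow> \<bar>snd z - snd W\<bar> \<le> D"
      proof -
        have "bounded ((\<lambda>z. snd z - snd W) ` \<Omega>)"
          by (intro compact_imp_bounded compact_continuous_image c continuous_intros)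
        then obtain D where "0 < D" "\<forall>x\<in>(\<lambda>z. snd z - snd W) ` \<Omega>. norm x \<le> D"
          using bounded_pos by blast
        then show ?thesis using that by auto
      qed
      \<comment> \<open>\<open>h\<close> small for the geometry, and \<open>s \<le> Q\<close> for \<open>ratio_unbounded\<close>\<close>
      define Q where "Q = (1 / (2 * (k + 1) * 2 powr p)) powr (1 / p)"
      define h where "h = min (1 / 16) (min (\<sigma> * (fst W - a) / (16 * D)) (Q / 8))"
      have Q: "0 < Q" using k by (simp add: Q_def)
      have small: "0 < h" "h \<le> 1 / 16" "h \<le> \<sigma> * (fst W - a) / (16 * D)" "8 * h \<le> Q"
        using Q Wpos D by (auto simp: h_def)
      obtain A B where AB: "A \<in> \<Omega>" "B \<in> \<Omega>" "snd A < snd B"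
        "\<sigma> * (fst A - a) \<le> h * (snd B - snd A)" "\<sigma> * (fst B - a) \<le> h * (snd B - snd A)"
        using not_angular_imp_steep[OF \<sigma> \<xi> small(1) side] na L(1) by blast
      have "h * (16 * D) \<le> \<sigma> * (fst W - a)" using small(3) D by (simp add: pos_le_divide_eq)
      then interpret steep_boundary \<Omega> \<sigma> a h D A B W
        using \<Omega> \<sigma> side small AB W D by unfold_locales auto
      have "s powr p \<le> Q powr p" using small pos p by (intro powr_mono2) (auto simp: s_def)
      also have "\<dots> = 1 / (2 * (k + 1) * 2 powr p)" using p k by (simp add: Q_def powr_powr)
      finally have "s powr p * (2 * (k + 1) * 2 powr p) \<le> 1" using k(1) by (subst (asm) pos_le_divide_eq) auto
      then have "(k + 1) * (2 powr p * s powr p) \<le> 1 / 2" by (simp add: algebra_simps)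
      moreover have "k * (2 powr p * s powr p) \<le> (k + 1) * (2 powr p * s powr p)"
        by (intro mult_right_mono) auto
      ultimately obtain u where "u \<in> concave_class \<Omega>" "\<exists>z\<in>\<Omega>. u z \<noteq> 0" "k * energy_y p \<Omega> u < energy_x p \<Omega> u"
        using ratio_unbounded[OF p k(1)] order_trans by blast
      with k(2)[of u] show False by simp
    qed
  next
    assume ang: "\<forall>L. vertical_line L \<and> support_line \<Omega> L \<longrightarrow> angular_support_line \<Omega> L"
    have extreme: "\<exists>\<xi>\<in>\<Omega>. \<exists>M>0. \<forall>z\<in>\<Omega>. \<bar>snd z - snd \<xi>\<bar> \<le> M * (\<sigma> * (fst z - fst \<xi>))" if \<sigma>: "\<sigma> = 1 \<or> \<sigma> = -1" for \<sigma> :: real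
    proof -
      have "continuous_on \<Omega> (\<lambda>z. \<sigma> * fst z)" by (intro continuous_intros)
      from continuous_attains_inf[OF c(1,2) this]
      obtain q where q: "q \<in> \<Omega>" "\<And>z. z \<in> \<Omega> \<Longrightarrow> \<sigma> * fst q \<le> \<sigma> * fst z"
        by blast
      have side: "0 \<le> \<sigma> * (fst z - fst q)" if "z \<in> \<Omega>" for z
        using q(2)[OF that] by (simp add: algebra_simps)
      have "angular_support_line \<Omega> {z. fst z = fst q}"
        using ang[rule_format, of "{z. fst z = fst q}"] \<sigma> q(1) side unfolding vertical_support_line_iff by blast
      from angular_imp_cone[OF \<Omega> \<sigma> side this] show ?thesis by metis
    qed
    obtain A M1 where A: "A \<in> \<Omega>" "0 < M1" "\<And>z. z \<in> \<Omega> \<Longrightarrow> \<bar>snd z - snd A\<bar> \<le> M1 * (fst z - fst A)"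
      using extreme[of 1] unfolding mult_1 by blast
    obtain B M2 where B: "B \<in> \<Omega>" "0 < M2" "\<And>z. z \<in> \<Omega> \<Longrightarrow> \<bar>snd z - snd B\<bar> \<le> M2 * (fst B - fst z)"
      using extreme[of "-1"] unfolding mult_minus1 minus_diff_eq by blast
    define M where "M = max M1 M2"
    have M: "0 < M" using A(2) by (simp add: M_def)
    have sideA: "0 \<le> fst z - fst A" and sideB: "0 \<le> fst B - fst z" if "z \<in> \<Omega>" for z
      using order_trans[OF abs_ge_zero A(3)[OF that]] order_trans[OF abs_ge_zero B(3)[OF that]] A(2) B(2)
      by (auto simp: zero_le_mult_iff)
    have "energy_x p \<Omega> u \<le> 2 powr p * ((2 * M) powr p + M powr p) * energy_y p \<Omega> u" if u: "u \<in> concave_class \<Omega>" for u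
    proof (rule energy_x_le_energy_y[OF u \<Omega> p M])
      show "(fst A, snd A) \<in> \<Omega>" "(fst B, snd B) \<in> \<Omega>" using A B by auto
      fix x y assume xy: "(x, y) \<in> \<Omega>"
      have "M1 * (x - fst A) \<le> M * (x - fst A)" "M2 * (fst B - x) \<le> M * (fst B - x)"
        using sideA[OF xy] sideB[OF xy] by (intro mult_right_mono; simp add: M_def)+
      then show "\<bar>y - snd A\<bar> \<le> M * (x - fst A)" "\<bar>y - snd B\<bar> \<le> M * (fst B - x)"
        using A(3)[OF xy] B(3)[OF xy] by auto
    qed
    then show "K p \<Omega> < \<infinity>" unfolding K_finite_iff[OF \<Omega> p]
      by (intro exI[of _ "2 powr p * ((2 * M) powr p + M powr p)"]) auto
  qed
qed

end
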